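(* Given an array of integers $\mathbf r=(1,r_1,r_2,\dots,r_{d-1},1)$, the set of rank-$\mathbf r$ tensors in the normalized tensor train format $$\mathcal N_{\mathbf r}=\big\{\mathcal X\in\mathbb C^{n_1\times n_2\times\cdots\times n_d}:\ \mathrm{rank}_{\mathrm{TT}}(\mathcal X)=\mathbf r,\ \|\mathcal X\|_{\mathrm F}=1\big\}$$ is a complex submanifold of $\mathbb C^{n_1\times n_2\times\cdots\times n_d}$.
   Context: For $\mathcal X\in\mathbb C^{n_1\times\cdots\times n_d}$ and $k\in\{1,\dots,d-1\}$, the $k$-th unfolding $\mathbf X_{\langle k\rangle}\in\mathbb C^{(n_1\cdots n_k)\times(n_{k+1}\cdots n_d)}$ is the matrix obtained by grouping the first $k$ indices $(i_1,\dots,i_k)$ into a row index and the remaining indices $(i_{k+1},\dots,i_d)$ into a column index. The tensor train (TT) rank is $\mathrm{rank}_{\mathrm{TT}}(\mathcal X)=(1,\mathrm{rank}(\mathbf X_{\langle 1\rangle}),\dots,\mathrm{rank}(\mathbf X_{\langle d-1\rangle}),1)$. The Frobenius norm is $\|\mathcal X\|_{\mathrm F}=\big(\sum_{i_1,\dots,i_d}|\mathcal X(i_1,\dots,i_d)|^2\big)^{1/2}$. A tensor in the normalized tensor train format is a tensor of unit Frobenius norm written in tensor train form, i.e., $\mathcal X(i_1,\dots,i_d)=\mathbf U_1(i_1)\mathbf U_2(i_2)\cdots\mathbf U_d(i_d)$ with matrices $\mathbf U_k(i_k)\in\mathbb C^{r_{k-1}\times r_k}$ and $r_0=r_d=1$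.
   Formalization: "Complex submanifold" is read as smooth embedded real submanifold of the complex tensor space viewed as a real vector space; with holomorphic charts the claim fails for every nonempty set (odd real dimension), e.g. d=1, n_1=1 gives the unit circle in C. *)

theory Defs
  imports "HOL-Analysis.Analysis" "Jordan_Normal_Form.DL_Rank"
begin

text \<open>All multi-indices (zero-based) of a tensor of size \<open>ns ! 0 \<times> \<dots> \<times> ns ! (d - 1)\<close>,
  in lexicographic order.\<close>

definition multi_indices :: "nat list \<Rightarrow> nat list list" where
  "multi_indices ns = product_lists (map (\<lambda>m. [0..<m]) ns)"

text \<open>The multi-indices for a given \<open>ns\<close> do not form a type, so the tensor space is \<open>complex ^ 'i\<close>
  for a finite type \<open>'i\<close> that is identified with the set of multi-indices by a
  bijection \<open>enc\<close>: the entry of \<open>X\<close> at \<open>(i\<^sub>1, \<dots>, i\<^sub>d)\<close> is the component of \<open>X\<close> at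
  \<open>enc [i\<^sub>1, \<dots>, i\<^sub>d]\<close>.\<close>

definition tensor_indexing :: "nat list \<Rightarrow> (nat list \<Rightarrow> 'i::finite) \<Rightarrow> bool" where
  "tensor_indexing ns enc \<longleftrightarrow> bij_betw enc (set (multi_indices ns)) UNIV"

definition entry :: "(nat list \<Rightarrow> 'i::finite) \<Rightarrow> complex ^ 'i \<Rightarrow> nat list \<Rightarrow> complex" where
  "entry enc X is = vec_nth X (enc is)"

definition tt_unfolding ::
  "nat list \<Rightarrow> (nat list \<Rightarrow> 'i::finite) \<Rightarrow> nat \<Rightarrow> complex ^ 'i \<Rightarrow> complex Matrix.mat" where
  "tt_unfolding ns enc k X =
     (let R = multi_indices (take k ns); C = multi_indices (drop k ns)
      in Matrix.mat (length R) (length C) (\<lambda>(a, b). entry enc X (R ! a @ C ! b)))"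

definition mat_rank :: "complex Matrix.mat \<Rightarrow> nat" where
  "mat_rank A = vec_space.rank (dim_row A) A"

definition tt_rank :: "nat list \<Rightarrow> (nat list \<Rightarrow> 'i::finite) \<Rightarrow> complex ^ 'i \<Rightarrow> nat list" where
  "tt_rank ns enc X =
     1 # map (\<lambda>k. mat_rank (tt_unfolding ns enc k X)) [1..<length ns] @ [1]"

definition frobenius_norm :: "nat list \<Rightarrow> (nat list \<Rightarrow> 'i::finite) \<Rightarrow> complex ^ 'i \<Rightarrow> real" where
  "frobenius_norm ns enc X = sqrt (\<Sum>is\<in>set (multi_indices ns). (cmod (entry enc X is))\<^sup>2)"

definition normalized_tt ::
  "nat list \<Rightarrow> (nat list \<Rightarrow> 'i::finite) \<Rightarrow> int list \<Rightarrow> (complex ^ 'i) set" where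
  "normalized_tt ns enc r = {X. map int (tt_rank ns enc X) = r \<and> frobenius_norm ns enc X = 1}"

text \<open>Continuous differentiability of order \<open>k\<close> and smoothness, meant for open sets \<open>S\<close>. In finite
  dimension, continuity of all directional derivatives \<open>x \<mapsto> Df(x) v\<close> is the same as continuity
  of \<open>Df\<close>.\<close>

primrec Ck_on ::
  "nat \<Rightarrow> 'a::euclidean_space set \<Rightarrow> ('a \<Rightarrow> 'b::euclidean_space) \<Rightarrow> bool" where
  "Ck_on 0 S f \<longleftrightarrow> continuous_on S f"
| "Ck_on (Suc k) S f \<longleftrightarrow>
     (\<forall>x\<in>S. f differentiable at x) \<and> (\<forall>v. Ck_on k S (\<lambda>x. frechet_derivative f (at x) v))"

definition smooth_on :: "'a::euclidean_space set \<Rightarrow> ('a \<Rightarrow> 'b::euclidean_space) \<Rightarrow> bool" where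
  "smooth_on S f \<longleftrightarrow> (\<forall>k. Ck_on k S f)"

definition diffeomorphism ::
  "'a::euclidean_space set \<Rightarrow> 'a set \<Rightarrow> ('a \<Rightarrow> 'a) \<Rightarrow> ('a \<Rightarrow> 'a) \<Rightarrow> bool" where
  "diffeomorphism U V \<phi> \<psi> \<longleftrightarrow>
     homeomorphism U V \<phi> \<psi> \<and> smooth_on U \<phi> \<and> smooth_on V \<psi>"

text \<open>Embedded \<open>m\<close>-dimensional submanifolds, by local slice charts. On \<open>complex ^ 'i\<close>,
  differentiability, subspaces and dimensions all refer to the underlying real vector space.
  Holomorphic charts are impossible for \<open>normalized_tt\<close>: a nonempty intersection of the unit sphere
  with a cone that is a complex submanifold away from 0 has odd real dimension.\<close>

definition submanifold_of_dim :: "nat \<Rightarrow> 'a::euclidean_space set \<Rightarrow> bool" where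
  "submanifold_of_dim m M \<longleftrightarrow>
     (\<forall>p\<in>M. \<exists>U V \<phi> \<psi> L. open U \<and> p \<in> U \<and> open V \<and> diffeomorphism U V \<phi> \<psi> \<and>
        Real_Vector_Spaces.subspace L \<and> Real_Vector_Spaces.dim L = m \<and> \<phi> ` (M \<inter> U) = V \<inter> L)"

definition embedded_submanifold :: "'a::euclidean_space set \<Rightarrow> bool" where
  "embedded_submanifold M \<longleftrightarrow> (\<exists>m. submanifold_of_dim m M)"

end

theory Submission
  imports Defs
begin

text \<open>Fix a tensor \<open>p\<close> of the set. The idea is to write down explicit rational coordinates near \<open>p\<close> in
which the rank conditions become linear, and then to cut with the sphere.

For a single matrix with an invertible pivot block \<open>A\<^sub>I\<^sub>J\<close> of size \<open>r\<close>, having rank \<open>r\<close> means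
that the Schur complement of the block vanishes (\<open>mat_rank_imp_schur\<close>, \<open>rows_span_imp_mat_rank\<close>).
The map that replaces the non-pivot entries by their Schur complement and keeps all the other entries
is invertible, because the correction involves only entries that are kept (\<open>elem_chart_shear\<close>).
So it flattens the matrices of rank \<open>r\<close>.

For a tensor the unfoldings are treated from left to right (\<open>chart_upto_Suc\<close>). Once the pivot rows of the
\<open>k\<close>-th unfolding span all its rows, these rows extended by the next index span all rows of the next
unfolding (\<open>rows_span_Suc\<close>). So the next rank condition concerns only a small matrix, made of
tensor entries that earlier steps have left alone, and it is flattened by another shear.
The coordinates that are straightened in different steps are disjoint; their number depends on
the shape and the prescribed ranks only, which gives the same dimension at every point.

The set of tensors of the given rank is a cone, and some coordinate that is never straightened is
nonzero at \<open>p\<close>. Dividing by a real linear functional of that coordinate separates the direction of a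
tensor from its norm and turns the flattening of the cone into one of its intersection with the unit
sphere (\<open>sphere_slice_chart\<close>), at the cost of one real dimension.\<close>

section \<open>Smoothness of elementary functions\<close>

text \<open>Charts and their inverses below are built from coordinates by field operations, complex conjugation
and one norm, which is a square root. A class of functions that is generated by these operations is
closed under directional derivatives, so that smoothness follows by induction on the order of
differentiability. A structural induction shows that it is closed under composition, which replaces
a chain rule for higher derivatives. Conjugation makes real parts and norms available.\<close>

inductive elem_on :: "(complex ^ 'i) set \<Rightarrow> (complex ^ 'i \<Rightarrow> complex) \<Rightarrow> bool" for S where
  coord: "elem_on S (\<lambda>x. vec_nth x e)"
| const: "elem_on S (\<lambda>_. c)"
| add: "elem_on S f \<Longrightarrow> elem_on S g \<Longrightarrow> elem_on S (\<lambda>x. f x + g x)"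
| mult: "elem_on S f \<Longrightarrow> elem_on S g \<Longrightarrow> elem_on S (\<lambda>x. f x * g x)"
| inv: "elem_on S f \<Longrightarrow> (\<And>x. x \<in> S \<Longrightarrow> f x \<noteq> 0) \<Longrightarrow> elem_on S (\<lambda>x. inverse (f x))"
| csqrt: "elem_on S f \<Longrightarrow> (\<And>x. x \<in> S \<Longrightarrow> f x \<notin> \<real>\<^sub>\<le>\<^sub>0) \<Longrightarrow> elem_on S (\<lambda>x. csqrt (f x))"
| cnj: "elem_on S f \<Longrightarrow> elem_on S (\<lambda>x. cnj (f x))"

lemma elem_on_uminus: "elem_on S f \<Longrightarrow> elem_on S (\<lambda>x. - f x)"
  using elem_on.mult[OF elem_on.const[of S "-1"], of f] by simp

lemma elem_on_diff: "elem_on S f \<Longrightarrow> elem_on S g \<Longrightarrow> elem_on S (\<lambda>x. f x - g x)"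
  using elem_on.add[OF _ elem_on_uminus, of S f g] by simp

lemma elem_on_divide:
  "elem_on S f \<Longrightarrow> elem_on S g \<Longrightarrow> (\<And>x. x \<in> S \<Longrightarrow> g x \<noteq> 0) \<Longrightarrow> elem_on S (\<lambda>x. f x / g x)"
  unfolding divide_inverse by (intro elem_on.mult elem_on.inv)

lemma elem_on_sum: "(\<And>a. a \<in> A \<Longrightarrow> elem_on S (f a)) \<Longrightarrow> elem_on S (\<lambda>x. \<Sum>a\<in>A. f a x)"
  by (induction A rule: infinite_finite_induct) (auto intro: elem_on.const elem_on.add)

lemma elem_on_prod: "(\<And>a. a \<in> A \<Longrightarrow> elem_on S (f a)) \<Longrightarrow> elem_on S (\<lambda>x. \<Prod>a\<in>A. f a x)"
  by (induction A rule: infinite_finite_induct) (auto intro: elem_on.const elem_on.mult)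

lemma elem_on_Re: "elem_on S f \<Longrightarrow> elem_on S (\<lambda>x. complex_of_real (Re (f x)))"
  using elem_on.mult[OF elem_on.const[of S "1/2"] elem_on.add[OF _ elem_on.cnj, of S f f]]
  by (simp add: complex_add_cnj)

lemma elem_on_subset: "elem_on S f \<Longrightarrow> T \<subseteq> S \<Longrightarrow> elem_on T f"
  by (induction rule: elem_on.induct) (auto intro: elem_on.intros)

lemma elem_on_norm:
  assumes "\<And>e. elem_on S (\<lambda>x. vec_nth (g x) e)" and "\<And>x. x \<in> S \<Longrightarrow> g x \<noteq> 0"
  shows "elem_on S (\<lambda>x. complex_of_real (norm (g x :: complex ^ 'i)))"
proof -
  have sq: "(\<Sum>e\<in>UNIV. vec_nth v e * cnj (vec_nth v e)) = complex_of_real ((norm v)\<^sup>2)"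
    for v :: "complex ^ 'i"
    by (simp add: norm_vec_def L2_set_def sum_nonneg complex_norm_square del: of_real_power)
  have "elem_on S (\<lambda>x. csqrt (\<Sum>e\<in>UNIV. vec_nth (g x) e * cnj (vec_nth (g x) e)))"
  proof (rule elem_on.csqrt)
    show "elem_on S (\<lambda>x. \<Sum>e\<in>UNIV. vec_nth (g x) e * cnj (vec_nth (g x) e))"
      by (intro elem_on_sum elem_on.mult elem_on.cnj assms)
    show "(\<Sum>e\<in>UNIV. vec_nth (g x) e * cnj (vec_nth (g x) e)) \<notin> \<real>\<^sub>\<le>\<^sub>0" if "x \<in> S" for x
      unfolding sq using assms(2)[OF that] by (simp del: of_real_power)
  qed
  moreover have "csqrt (complex_of_real ((norm v)\<^sup>2)) = complex_of_real (norm v)"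
    for v :: "complex ^ 'i"
    by (subst csqrt_of_real) (auto simp del: of_real_power)
  ultimately show ?thesis unfolding sq by simp
qed

text \<open>Coordinates are the only rule of the inductive definition that looks at the argument, so substituting
a map whose components are elementary only asks for the coordinate case.\<close>

lemma elem_on_compose:
  assumes "elem_on T f" and "\<And>e. elem_on S (\<lambda>x. vec_nth (g x) e)" and "g ` S \<subseteq> T"
  shows "elem_on S (\<lambda>x. f (g x))"
  using assms(1)
proof (induction rule: elem_on.induct)
  case (inv f)
  show ?case by (rule elem_on.inv) (use inv assms(3) in auto)
next
  case (csqrt f)
  show ?case by (rule elem_on.csqrt) (use csqrt assms(3) in auto)
qed (simp_all add: assms(2) elem_on.const elem_on.add elem_on.mult elem_on.cnj)

lemma elem_on_has_derivative:
  assumes "elem_on S f"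
  shows "\<exists>f'. (\<forall>x\<in>S. (f has_derivative f' x) (at x)) \<and> (\<forall>v. elem_on S (\<lambda>x. f' x v))"
  using assms
proof (induction rule: elem_on.induct)
  case (coord e)
  show ?case
    by (intro exI[of _ "\<lambda>x v. vec_nth v e"] conjI ballI allI elem_on.const
        bounded_linear_imp_has_derivative bounded_linear_vec_nth)
next
  case (const c)
  show ?case by (intro exI[of _ "\<lambda>x v. 0"] conjI ballI allI elem_on.const has_derivative_const)
next
  case (add f g)
  then obtain f' g' where
    "\<forall>x\<in>S. (f has_derivative f' x) (at x)" "\<forall>v. elem_on S (\<lambda>x. f' x v)"
    "\<forall>x\<in>S. (g has_derivative g' x) (at x)" "\<forall>v. elem_on S (\<lambda>x. g' x v)" by blast
  then show ?case
    by (intro exI[of _ "\<lambda>x v. f' x v + g' x v"])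
      (auto intro: elem_on.add has_derivative_add)
next
  case (mult f g)
  then obtain f' g' where
    "\<forall>x\<in>S. (f has_derivative f' x) (at x)" "\<forall>v. elem_on S (\<lambda>x. f' x v)"
    "\<forall>x\<in>S. (g has_derivative g' x) (at x)" "\<forall>v. elem_on S (\<lambda>x. g' x v)" by blast
  then show ?case
    by (intro exI[of _ "\<lambda>x v. f x * g' x v + f' x v * g x"])
      (auto intro!: elem_on.add elem_on.mult has_derivative_mult mult.hyps)
next
  case (inv f)
  then obtain f' where f': "\<forall>x\<in>S. (f has_derivative f' x) (at x)" "\<forall>v. elem_on S (\<lambda>x. f' x v)"
    by blast
  show ?case
    by (intro exI[of _ "\<lambda>x v. - (inverse (f x) * f' x v * inverse (f x))"])
      (use f' inv.hyps in \<open>auto intro!: elem_on_uminus elem_on.mult elem_on.inv Deriv.has_derivative_inverse\<close>)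
next
  case (csqrt f)
  then obtain f' where f': "\<forall>x\<in>S. (f has_derivative f' x) (at x)" "\<forall>v. elem_on S (\<lambda>x. f' x v)"
    by blast
  have "((\<lambda>x. Complex.csqrt (f x)) has_derivative (\<lambda>v. inverse (2 * Complex.csqrt (f x)) * f' x v)) (at x)"
    if "x \<in> S" for x
    using has_derivative_compose[of f "f' x" x UNIV Complex.csqrt "(*) (inverse (2 * Complex.csqrt (f x)))"]
      f'(1) that has_field_derivative_csqrt[OF csqrt.hyps(2)[OF that]]
    by (simp add: has_field_derivative_def)
  moreover have "Complex.csqrt (f x) \<noteq> 0" if "x \<in> S" for x
    using csqrt.hyps(2)[OF that] by auto
  moreover have "elem_on S (\<lambda>x. inverse (2 * Complex.csqrt (f x)) * f' x v)" for v
    by (intro elem_on.mult elem_on.inv elem_on.const elem_on.csqrt csqrt.hyps f'(2)[rule_format])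
      (use calculation(2) in simp_all)
  ultimately show ?case
    by (intro exI[of _ "\<lambda>x v. inverse (2 * Complex.csqrt (f x)) * f' x v"] conjI ballI allI)
next
  case (cnj f)
  then obtain f' where "\<forall>x\<in>S. (f has_derivative f' x) (at x)" "\<forall>v. elem_on S (\<lambda>x. f' x v)"
    by blast
  then show ?case
    by (intro exI[of _ "\<lambda>x v. Complex.cnj (f' x v)"])
      (auto intro: elem_on.cnj bounded_linear.has_derivative[OF bounded_linear_cnj])
qed

definition elem_map_on :: "(complex ^ 'i) set \<Rightarrow> (complex ^ 'i \<Rightarrow> complex ^ 'i) \<Rightarrow> bool" where
  "elem_map_on S F \<longleftrightarrow> (\<forall>e. elem_on S (\<lambda>x. vec_nth (F x) e))"

lemma elem_map_on_has_derivative: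
  assumes "elem_map_on S (F :: complex ^ 'i \<Rightarrow> complex ^ 'i)"
  shows "\<exists>F'. (\<forall>x\<in>S. (F has_derivative F' x) (at x)) \<and> (\<forall>v. elem_map_on S (\<lambda>x. F' x v))"
proof -
  have "\<exists>f'. (\<forall>x\<in>S. ((\<lambda>x. vec_nth (F x) e) has_derivative f' x) (at x)) \<and> (\<forall>v. elem_on S (\<lambda>x. f' x v))"
    for e
    by (rule elem_on_has_derivative) (use assms in \<open>auto simp: elem_map_on_def\<close>)
  then obtain f' where f': "\<And>e x. x \<in> S \<Longrightarrow> ((\<lambda>x. vec_nth (F x) e) has_derivative f' e x) (at x)"
    "\<And>e v. elem_on S (\<lambda>x. f' e x v)"
    by metis
  have "(F has_derivative (\<lambda>v. \<chi> e. f' e x v)) (at x)" if "x \<in> S" for x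
  proof (subst has_derivative_componentwise_within, intro ballI)
    fix b :: "complex ^ 'i"
    assume "b \<in> Basis"
    then obtain e u where b: "b = axis e u" by (auto simp: Basis_vec_def)
    show "((\<lambda>y. inner (F y) b) has_derivative (\<lambda>v. inner (\<chi> e. f' e x v) b)) (at x)"
      unfolding b inner_axis by (simp, intro has_derivative_inner_left f' that)
  qed
  then show ?thesis
    by (intro exI[of _ "\<lambda>x v. \<chi> e. f' e x v"]) (simp add: elem_map_on_def f')
qed

text \<open>The auxiliary \<open>G\<close> makes the induction work: the Frechet derivative of \<open>F\<close> equals an elementary map
on \<open>S\<close> only, since its values off \<open>S\<close> are unknown.\<close>

lemma elem_map_on_Ck:
  assumes "open S" and "elem_map_on S G" and "\<And>x. x \<in> S \<Longrightarrow> F x = G x"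
  shows "Ck_on k S F"
  using assms(2,3)
proof (induction k arbitrary: F G)
  case (0 F G)
  obtain G' where "\<forall>x\<in>S. (G has_derivative G' x) (at x)"
    using elem_map_on_has_derivative[OF 0(1)] by blast
  then have "continuous_on S G"
    by (meson continuous_at_imp_continuous_on has_derivative_continuous)
  then show ?case using 0(2) by (simp cong: continuous_on_cong)
next
  case (Suc k F G)
  obtain G' where G': "\<And>x. x \<in> S \<Longrightarrow> (G has_derivative G' x) (at x)"
    "\<And>v. elem_map_on S (\<lambda>x. G' x v)"
    using elem_map_on_has_derivative[OF Suc.prems(1)] by blast
  have F': "(F has_derivative G' x) (at x)" if "x \<in> S" for x
    by (rule has_derivative_transform_within_open[OF G'(1)[OF that] assms(1) that])
      (simp add: Suc.prems(2))
  then have "F differentiable at x" if "x \<in> S" for x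
    using that by (auto simp: differentiable_def)
  moreover have "Ck_on k S (\<lambda>x. frechet_derivative F (at x) v)" for v
    by (rule Suc.IH[OF G'(2)[of v]]) (simp add: frechet_derivative_at[OF F'])
  ultimately show ?case by simp
qed

lemma elem_map_on_smooth: "open S \<Longrightarrow> elem_map_on S F \<Longrightarrow> smooth_on S F"
  unfolding smooth_on_def using elem_map_on_Ck by blast

lemma elem_map_on_continuous: "open S \<Longrightarrow> elem_map_on S F \<Longrightarrow> continuous_on S F"
  using elem_map_on_Ck[of S F F 0] by simp

lemma elem_on_continuous:
  assumes "elem_on S f"
  shows "continuous_on S f"
  using elem_on_has_derivative[OF assms]
  by (meson continuous_at_imp_continuous_on has_derivative_continuous)

lemma elem_map_on_compose:
  assumes "elem_map_on T F" and "elem_map_on S G" and "G ` S \<subseteq> T"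
  shows "elem_map_on S (\<lambda>x. F (G x))"
  using assms elem_on_compose unfolding elem_map_on_def by blast

text \<open>A chart and its inverse, both elementary on open sets. This is stronger than a diffeomorphism, and
unlike smoothness it is seen directly to be stable under composition.\<close>

definition elem_chart :: "(complex ^ 'i) set \<Rightarrow> (complex ^ 'i) set \<Rightarrow>
    (complex ^ 'i \<Rightarrow> complex ^ 'i) \<Rightarrow> (complex ^ 'i \<Rightarrow> complex ^ 'i) \<Rightarrow> bool" where
  "elem_chart U V \<phi> \<psi> \<longleftrightarrow> open U \<and> open V \<and> elem_map_on U \<phi> \<and> elem_map_on V \<psi> \<and>
     (\<forall>x\<in>U. \<phi> x \<in> V \<and> \<psi> (\<phi> x) = x) \<and> (\<forall>y\<in>V. \<psi> y \<in> U \<and> \<phi> (\<psi> y) = y)"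

lemma elem_chartD:
  assumes "elem_chart U V \<phi> \<psi>"
  shows "open U" "open V" "elem_map_on U \<phi>" "elem_map_on V \<psi>"
    "x \<in> U \<Longrightarrow> \<phi> x \<in> V" "x \<in> U \<Longrightarrow> \<psi> (\<phi> x) = x"
    "y \<in> V \<Longrightarrow> \<psi> y \<in> U" "y \<in> V \<Longrightarrow> \<phi> (\<psi> y) = y"
  using assms unfolding elem_chart_def by simp_all

lemma elem_chart_diffeomorphism:
  assumes "elem_chart U V \<phi> \<psi>"
  shows "diffeomorphism U V \<phi> \<psi>"
proof -
  note 1 = elem_chartD[OF assms]
  have "homeomorphism U V \<phi> \<psi>"
    by (rule homeomorphismI) (use 1 elem_map_on_continuous in auto)
  then show ?thesis
    by (simp add: diffeomorphism_def 1 elem_map_on_smooth)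
qed

lemma elem_chart_compose:
  assumes "elem_chart U V \<phi> \<psi>" and "elem_chart U' V' \<phi>' \<psi>'"
  shows "elem_chart {x \<in> U. \<phi> x \<in> U'} {y \<in> V'. \<psi>' y \<in> V} (\<lambda>x. \<phi>' (\<phi> x)) (\<lambda>y. \<psi> (\<psi>' y))"
proof -
  have o: "open {x \<in> A. f x \<in> B}" if "open A" "open B" "elem_map_on A f"
    for A B and f :: "complex ^ 'i \<Rightarrow> complex ^ 'i"
    using continuous_open_preimage[OF elem_map_on_continuous[OF that(1,3)] that(1,2)]
    by (simp add: vimage_def Collect_conj_eq)
  have s: "elem_map_on T f" if "elem_map_on A f" "T \<subseteq> A" for A T and f :: "complex ^ 'i \<Rightarrow> complex ^ 'i"
    using that(1) elem_on_subset[OF _ that(2)] unfolding elem_map_on_def by blast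
  note 1 = elem_chartD[OF assms(1)] and 2 = elem_chartD[OF assms(2)]
  have m: "elem_map_on {x \<in> U. \<phi> x \<in> U'} (\<lambda>x. \<phi>' (\<phi> x))"
    by (rule elem_map_on_compose[OF 2(3) s[OF 1(3)]]) auto
  have m': "elem_map_on {y \<in> V'. \<psi>' y \<in> V} (\<lambda>y. \<psi> (\<psi>' y))"
    by (rule elem_map_on_compose[OF 1(4) s[OF 2(4)]]) auto
  show ?thesis
    unfolding elem_chart_def
  proof (intro conjI ballI o m m' 1 2)
  qed (use 1(5-) 2(5-) in auto)
qed

section \<open>Pivot blocks, Schur complements and rank\<close>

text \<open>Pivot sets of rows and columns are abstract finite sets, whereas determinants and adjugates need
numbered rows and columns; an arbitrary enumeration links the two.\<close>

definition enumeration :: "'a set \<Rightarrow> 'a list" where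
  "enumeration A = (SOME xs. set xs = A \<and> distinct xs)"

lemma enumeration:
  assumes "finite A"
  shows "distinct (enumeration A)" "set (enumeration A) = A" "length (enumeration A) = card A"
proof -
  have "set (enumeration A) = A \<and> distinct (enumeration A)"
    unfolding enumeration_def using finite_distinct_list[OF assms] by (rule someI_ex)
  then show "distinct (enumeration A)" "set (enumeration A) = A" by simp_all
  then show "length (enumeration A) = card A" using distinct_card by metis
qed

lemma bij_betw_enumeration: "finite A \<Longrightarrow> bij_betw ((!) (enumeration A)) {..<card A} A"
  using bij_betw_nth[of "enumeration A" "{..<card A}" A] enumeration[of A] by simp

lemma enumeration_nth_mem: "finite A \<Longrightarrow> k < card A \<Longrightarrow> enumeration A ! k \<in> A"
  using enumeration nth_mem by metis

definition block :: "'x set \<Rightarrow> 'y set \<Rightarrow> ('x \<Rightarrow> 'y \<Rightarrow> complex) \<Rightarrow> complex Matrix.mat" where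
  "block I J f = Matrix.mat (card I) (card J) (\<lambda>(a, b). f (enumeration I ! a) (enumeration J ! b))"

definition position :: "'a set \<Rightarrow> 'a \<Rightarrow> nat" where
  "position A = the_inv_into {..<card A} ((!) (enumeration A))"

lemma position:
  assumes "finite A" "a \<in> A"
  shows "position A a < card A" "enumeration A ! position A a = a"
proof -
  note b = bij_betw_enumeration[OF assms(1)]
  show "position A a < card A"
    using the_inv_into_into[of "(!) (enumeration A)" "{..<card A}" a "{..<card A}"] b assms(2)
    by (auto simp: position_def bij_betw_def)
  show "enumeration A ! position A a = a"
    using f_the_inv_into_f_bij_betw[OF b] assms(2) by (auto simp: position_def)
qed

lemma position_inj: "finite A \<Longrightarrow> a \<in> A \<Longrightarrow> b \<in> A \<Longrightarrow> position A a = position A b \<longleftrightarrow> a = b"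
  using position by metis

text \<open>Cramer's rule. The entries of the inverse are rational functions of the entries of the block, hence
elementary wherever the block is invertible. The columns of the inverse are indexed by \<open>I\<close> and its
rows by \<open>J\<close>.\<close>

definition block_inv :: "'x set \<Rightarrow> 'y set \<Rightarrow> ('x \<Rightarrow> 'y \<Rightarrow> complex) \<Rightarrow> 'y \<Rightarrow> 'x \<Rightarrow> complex" where
  "block_inv I J f b a = adj_mat (block I J f) $$ (position J b, position I a) / Determinant.det (block I J f)"

definition cols_indep :: "'x set \<Rightarrow> 'y set \<Rightarrow> ('x \<Rightarrow> 'y \<Rightarrow> complex) \<Rightarrow> bool" where
  "cols_indep P J f \<longleftrightarrow> (\<forall>c. (\<forall>i\<in>P. (\<Sum>j\<in>J. f i j * c j) = 0) \<longrightarrow> (\<forall>j\<in>J. c j = 0))"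

lemma cols_indepD: "cols_indep P J f \<Longrightarrow> (\<And>i. i \<in> P \<Longrightarrow> (\<Sum>j\<in>J. f i j * c j) = 0) \<Longrightarrow> j \<in> J \<Longrightarrow> c j = 0"
  unfolding cols_indep_def by blast

lemma cols_indep_mono: "cols_indep P J f \<Longrightarrow> P \<subseteq> Q \<Longrightarrow> cols_indep Q J f"
  unfolding cols_indep_def by blast

lemma block_cong:
  assumes "finite I" "finite J" "\<And>a b. a \<in> I \<Longrightarrow> b \<in> J \<Longrightarrow> f a b = g a b"
  shows "block I J f = block I J g"
  unfolding block_def by (intro cong_mat) (simp_all add: assms enumeration_nth_mem)

lemma det_block_iff:
  assumes "finite I" "finite J" "card I = card J"
  shows "Determinant.det (block I J f) \<noteq> 0 \<longleftrightarrow> cols_indep I J f"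
proof -
  let ?r = "card J"
  have B: "block I J f \<in> carrier_mat ?r ?r" using assms(3) by (simp add: block_def)
  note bI = bij_betw_enumeration[OF assms(1)] and bJ = bij_betw_enumeration[OF assms(2)]
  have mv: "vec_index (block I J f *\<^sub>v v) a = (\<Sum>j\<in>J. f (enumeration I ! a) j * vec_index v (position J j))"
    if "v \<in> carrier_vec ?r" "a < ?r" for v a
  proof -
    have "vec_index (block I J f *\<^sub>v v) a = (\<Sum>k<?r. f (enumeration I ! a) (enumeration J ! k) * vec_index v k)"
      using that assms(3) by (simp add: block_def scalar_prod_def atLeast0LessThan)
    also have "\<dots> = (\<Sum>k<?r. f (enumeration I ! a) (enumeration J ! k) * vec_index v (position J (enumeration J ! k)))"
    proof (rule sum.cong[OF refl])
      fix k assume "k \<in> {..<?r}"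
      then have "position J (enumeration J ! k) = k"
        using bJ by (simp add: position_def bij_betw_def the_inv_into_f_f)
      then show "f (enumeration I ! a) (enumeration J ! k) * vec_index v k
        = f (enumeration I ! a) (enumeration J ! k) * vec_index v (position J (enumeration J ! k))" by simp
    qed
    also have "\<dots> = (\<Sum>j\<in>J. f (enumeration I ! a) j * vec_index v (position J j))"
      by (rule sum.reindex_bij_betw[OF bJ])
    finally show ?thesis .
  qed
  have I_ex: "\<exists>a<?r. i = enumeration I ! a" if "i \<in> I" for i
    using position[OF assms(1) that] assms(3) by metis
  have I_in: "enumeration I ! a \<in> I" if "a < ?r" for a
    using bI assms(3) that by (auto simp: bij_betw_def)
  have "(\<exists>v. v \<in> carrier_vec ?r \<and> v \<noteq> 0\<^sub>v ?r \<and> block I J f *\<^sub>v v = 0\<^sub>v ?r) \<longleftrightarrow> \<not> cols_indep I J f"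
  proof
    assume "\<exists>v. v \<in> carrier_vec ?r \<and> v \<noteq> 0\<^sub>v ?r \<and> block I J f *\<^sub>v v = 0\<^sub>v ?r"
    then obtain v where v: "v \<in> carrier_vec ?r" "v \<noteq> 0\<^sub>v ?r" "block I J f *\<^sub>v v = 0\<^sub>v ?r" by blast
    then obtain k where k: "k < ?r" "vec_index v k \<noteq> 0" by (auto simp: Matrix.vec_eq_iff)
    have "(\<Sum>j\<in>J. f i j * vec_index v (position J j)) = 0" if "i \<in> I" for i
      using I_ex[OF that] mv[OF v(1)] v(3) by (metis index_zero_vec(1))
    moreover have "enumeration J ! k \<in> J" "position J (enumeration J ! k) = k"
      using k bJ by (auto simp: position_def bij_betw_def the_inv_into_f_f)
    ultimately show "\<not> cols_indep I J f"
      using k(2) cols_indepD[of I J f "\<lambda>j. vec_index v (position J j)" "enumeration J ! k"] by auto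
  next
    assume "\<not> cols_indep I J f"
    then obtain c j where c: "\<And>i. i \<in> I \<Longrightarrow> (\<Sum>j\<in>J. f i j * c j) = 0" "j \<in> J" "c j \<noteq> 0"
      unfolding cols_indep_def by blast
    let ?v = "Matrix.vec ?r (\<lambda>k. c (enumeration J ! k))"
    have "vec_index ?v (position J j) \<noteq> 0" using position[OF assms(2) c(2)] c(3) by simp
    then have "?v \<noteq> 0\<^sub>v ?r" using position[OF assms(2) c(2)] by (metis index_zero_vec(1))
    moreover have "block I J f *\<^sub>v ?v = 0\<^sub>v ?r"
    proof (rule eq_vecI)
      fix a assume "a < dim_vec (0\<^sub>v ?r :: complex Matrix.vec)"
      then have a: "a < ?r" by simp
      have "(\<Sum>j\<in>J. f (enumeration I ! a) j * vec_index ?v (position J j)) = (\<Sum>j\<in>J. f (enumeration I ! a) j * c j)"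
        using position[OF assms(2)] by (intro sum.cong) auto
      then show "vec_index (block I J f *\<^sub>v ?v) a = vec_index (0\<^sub>v ?r) a"
        using mv[of ?v a] a c(1)[OF I_in[OF a]] by simp
    qed (use B in auto)
    ultimately show "\<exists>v. v \<in> carrier_vec ?r \<and> v \<noteq> 0\<^sub>v ?r \<and> block I J f *\<^sub>v v = 0\<^sub>v ?r"
      by (intro exI[of _ ?v]) simp
  qed
  then show ?thesis using det_0_iff_vec_prod_zero[OF B] by blast
qed

lemma block_inv:
  assumes "finite I" "finite J" "card I = card J" "cols_indep I J f"
  shows "a \<in> I \<Longrightarrow> a' \<in> I \<Longrightarrow> (\<Sum>b\<in>J. f a b * block_inv I J f b a') = (if a = a' then 1 else 0)"
    and "b \<in> J \<Longrightarrow> b' \<in> J \<Longrightarrow> (\<Sum>a\<in>I. block_inv I J f b a * f a b') = (if b = b' then 1 else 0)"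
proof -
  let ?r = "card J" and ?B = "block I J f"
  let ?d = "Determinant.det ?B"
  have B: "?B \<in> carrier_mat ?r ?r" using assms(3) by (simp add: block_def)
  have d: "?d \<noteq> 0" using det_block_iff assms by blast
  note adj = adj_mat[OF B]
  have el: "?B $$ (position I a, position J b) = f a b" if "a \<in> I" "b \<in> J" for a b
    using position[OF assms(1) that(1)] position[OF assms(2) that(2)] assms(3) by (simp add: block_def)
  have reI: "(\<Sum>k<?r. h k) = (\<Sum>a\<in>I. h (position I a))" for h :: "nat \<Rightarrow> complex"
    using sum.reindex_bij_betw[OF bij_betw_the_inv_into[OF bij_betw_enumeration[OF assms(1)]], of h] assms(3)
    by (simp add: position_def)
  have reJ: "(\<Sum>k<?r. h k) = (\<Sum>b\<in>J. h (position J b))" for h :: "nat \<Rightarrow> complex"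
    using sum.reindex_bij_betw[OF bij_betw_the_inv_into[OF bij_betw_enumeration[OF assms(2)]], of h]
    by (simp add: position_def)
  show "(\<Sum>b\<in>J. f a b * block_inv I J f b a') = (if a = a' then 1 else 0)" if aa: "a \<in> I" "a' \<in> I"
  proof -
    have p: "position I a < ?r" "position I a' < ?r" using position[OF assms(1)] aa assms(3) by auto
    have "(\<Sum>k<?r. ?B $$ (position I a, k) * adj_mat ?B $$ (k, position I a'))
        = (?B * adj_mat ?B) $$ (position I a, position I a')"
      using p B adj(1) by (simp add: scalar_prod_def atLeast0LessThan)
    also have "\<dots> = (if a = a' then ?d else 0)"
      unfolding adj(2) using p position_inj[OF assms(1) aa] by simp
    finally have "(\<Sum>b\<in>J. f a b * adj_mat ?B $$ (position J b, position I a')) = (if a = a' then ?d else 0)"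
      unfolding reJ using el[OF aa(1)] by simp
    moreover have "(\<Sum>b\<in>J. f a b * block_inv I J f b a')
        = (\<Sum>b\<in>J. f a b * adj_mat ?B $$ (position J b, position I a')) / ?d"
      by (simp add: block_inv_def sum_divide_distrib)
    ultimately show ?thesis using d by simp
  qed
  show "(\<Sum>a\<in>I. block_inv I J f b a * f a b') = (if b = b' then 1 else 0)" if bb: "b \<in> J" "b' \<in> J"
  proof -
    have p: "position J b < ?r" "position J b' < ?r" using position[OF assms(2)] bb by auto
    have "(\<Sum>k<?r. adj_mat ?B $$ (position J b, k) * ?B $$ (k, position J b'))
        = (adj_mat ?B * ?B) $$ (position J b, position J b')"
      using p B adj(1) by (simp add: scalar_prod_def atLeast0LessThan)
    also have "\<dots> = (if b = b' then ?d else 0)"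
      unfolding adj(3) using p position_inj[OF assms(2) bb] by simp
    finally have "(\<Sum>a\<in>I. adj_mat ?B $$ (position J b, position I a) * f a b') = (if b = b' then ?d else 0)"
      unfolding reI using el[OF _ bb(2)] by simp
    moreover have "(\<Sum>a\<in>I. block_inv I J f b a * f a b')
        = (\<Sum>a\<in>I. adj_mat ?B $$ (position J b, position I a) * f a b') / ?d"
      by (simp add: block_inv_def sum_divide_distrib)
    ultimately show ?thesis using d by simp
  qed
qed

lemma elem_on_det:
  assumes "\<And>x. A x \<in> carrier_mat n n"
    and "\<And>i j. i < n \<Longrightarrow> j < n \<Longrightarrow> elem_on S (\<lambda>x. A x $$ (i, j))"
  shows "elem_on S (\<lambda>x. Determinant.det (A x))"
proof -
  have "elem_on S (\<lambda>x. \<Sum>p\<in>{p. p permutes {0..<n}}. signof p * (\<Prod>i=0..<n. A x $$ (i, p i)))"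
  proof (intro elem_on_sum elem_on.mult elem_on.const elem_on_prod assms(2))
    fix p i assume "p \<in> {p. p permutes {0..<n}}" and "i \<in> {0..<n}"
    then show "i < n" "p i < n" using permutes_in_image[of p "{0..<n}" i] by auto
  qed
  moreover have "Determinant.det (A x)
    = (\<Sum>p\<in>{p. p permutes {0..<n}}. signof p * (\<Prod>i=0..<n. A x $$ (i, p i)))" for x
    using assms(1)[of x] by (simp add: Determinant.det_def)
  ultimately show ?thesis by simp
qed

lemma elem_on_det_block:
  assumes "card I = card J" and "\<And>a b. elem_on S (\<lambda>x. F x a b)"
  shows "elem_on S (\<lambda>x. Determinant.det (block I J (F x)))"
  by (rule elem_on_det[of _ "card J"]) (use assms in \<open>auto simp: block_def\<close>)

lemma elem_on_block_inv:
  assumes "finite I" "finite J" "card I = card J" and F: "\<And>a b. elem_on S (\<lambda>x. F x a b)"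
    and "\<And>x. x \<in> S \<Longrightarrow> cols_indep I J (F x)" and "a \<in> I" "b \<in> J"
  shows "elem_on S (\<lambda>x. block_inv I J (F x) b a)"
proof -
  have p: "position I a < card J" "position J b < card J"
    using position[OF assms(1,6)] position[OF assms(2,7)] assms(3) by auto
  have B: "block I J (F x) \<in> carrier_mat (card J) (card J)" for x
    using assms(3) by (simp add: block_def)
  have adj: "adj_mat (block I J (F x)) $$ (position J b, position I a)
    = (-1) ^ (position I a + position J b) * Determinant.det (mat_delete (block I J (F x)) (position I a) (position J b))"
    for x using p B[of x] by (simp add: adj_mat_def Determinant.cofactor_def)
  have "elem_on S (\<lambda>x. Determinant.det (mat_delete (block I J (F x)) (position I a) (position J b)))"
  proof (rule elem_on_det[of _ "card J - 1"])
    show "mat_delete (block I J (F x)) (position I a) (position J b) \<in> carrier_mat (card J - 1) (card J - 1)" for x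
      using B[of x] by (simp add: mat_delete_def)
    show "elem_on S (\<lambda>x. mat_delete (block I J (F x)) (position I a) (position J b) $$ (i, j))"
      if "i < card J - 1" "j < card J - 1" for i j
      using that p F assms(3) by (auto simp: mat_delete_def block_def)
  qed
  then show ?thesis
    unfolding block_inv_def adj
    by (intro elem_on_divide elem_on.mult elem_on.const elem_on_det_block assms(3) F)
      (use det_block_iff[OF assms(1-3)] assms(5) in auto)
qed

text \<open>The product \<open>A\<^sub>P\<^sub>J A\<^sub>I\<^sub>J\<^sup>-\<^sup>1 A\<^sub>I\<^sub>D\<close> that is subtracted in the Schur complement of the pivot block
\<open>A\<^sub>I\<^sub>J\<close>. A matrix of rank \<open>card I\<close> with invertible pivot block is equal to this product.\<close>

definition schur :: "'x set \<Rightarrow> 'y set \<Rightarrow> ('x \<Rightarrow> 'y \<Rightarrow> complex) \<Rightarrow> 'x \<Rightarrow> 'y \<Rightarrow> complex" where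
  "schur I J f i j = (\<Sum>b\<in>J. f i b * (\<Sum>a\<in>I. block_inv I J f b a * f a j))"

text \<open>The determinant of the bordered block is the determinant of the block times the Schur complement
at \<open>(i, b)\<close>. Here only the resulting independence of the columns is proved, by eliminating the
coefficients of the columns in \<open>J\<close> from a linear relation.\<close>

lemma cols_indep_bordered:
  assumes "finite I" "finite J" "card I = card J" "cols_indep I J f"
    and "b \<notin> J" and "f i b \<noteq> schur I J f i b"
  shows "cols_indep (insert i I) (insert b J) f"
  unfolding cols_indep_def
proof (intro allI impI)
  fix c
  assume *: "\<forall>i\<in>insert i I. (\<Sum>j\<in>insert b J. f i j * c j) = 0"
  have c: "f a b * c b + (\<Sum>j\<in>J. f a j * c j) = 0" if "a \<in> insert i I" for a
    using bspec[OF * that] assms(2,5) by simp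
  have cj: "c j = - (\<Sum>a\<in>I. block_inv I J f j a * f a b) * c b" if "j \<in> J" for j
  proof -
    have "c j = (\<Sum>j'\<in>J. (if j = j' then 1 else 0) * c j')"
      using that assms(2) by (simp add: if_distrib[of "\<lambda>x. x * _"] cong: if_cong)
    also have "\<dots> = (\<Sum>j'\<in>J. (\<Sum>a\<in>I. block_inv I J f j a * f a j') * c j')"
      by (intro sum.cong refl) (use block_inv(2)[OF assms(1-4) that] in simp)
    also have "\<dots> = (\<Sum>a\<in>I. block_inv I J f j a * (\<Sum>j'\<in>J. f a j' * c j'))"
      unfolding sum_distrib_left sum_distrib_right mult.assoc by (rule sum.swap)
    also have "\<dots> = (\<Sum>a\<in>I. block_inv I J f j a * (- (f a b * c b)))"
    proof (intro sum.cong refl)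
      fix a assume "a \<in> I"
      then have "(\<Sum>j'\<in>J. f a j' * c j') = - (f a b * c b)"
        using c[of a] by (simp add: eq_neg_iff_add_eq_0 add.commute)
      then show "block_inv I J f j a * (\<Sum>j'\<in>J. f a j' * c j') = block_inv I J f j a * (- (f a b * c b))"
        by simp
    qed
    also have "\<dots> = - (\<Sum>a\<in>I. block_inv I J f j a * f a b) * c b"
      by (simp add: sum_distrib_right mult.assoc flip: sum_negf)
    finally show ?thesis .
  qed
  have "(\<Sum>j\<in>J. f i j * c j)
      = (\<Sum>j\<in>J. - (f i j * (\<Sum>a\<in>I. block_inv I J f j a * f a b)) * c b)"
    by (intro sum.cong refl) (metis cj minus_mult_left minus_mult_right mult.assoc)
  also have "\<dots> = - schur I J f i b * c b"
    by (simp only: schur_def flip: sum_negf sum_distrib_right)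
  finally have "(\<Sum>j\<in>J. f i j * c j) = - schur I J f i b * c b" .
  then have "(f i b - schur I J f i b) * c b = 0"
    using c[of i] by (simp add: algebra_simps)
  then have "c b = 0" using assms(6) by simp
  then show "\<forall>j\<in>insert b J. c j = 0" using cj by simp
qed

lemma schur_pivot_row:
  assumes "finite I" "finite J" "card I = card J" "cols_indep I J f" and "i \<in> I"
  shows "schur I J f i j = f i j"
proof -
  have "schur I J f i j = (\<Sum>a\<in>I. (\<Sum>b\<in>J. f i b * block_inv I J f b a) * f a j)"
    unfolding schur_def sum_distrib_left sum_distrib_right mult.assoc by (rule sum.swap)
  also have "\<dots> = (\<Sum>a\<in>I. (if i = a then 1 else 0) * f a j)"
    by (intro sum.cong refl) (use block_inv(1)[OF assms] in simp)
  also have "\<dots> = f i j" using assms by (simp add: if_distrib[of "\<lambda>x. x * _"] cong: if_cong)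
  finally show ?thesis .
qed

lemma schur_pivot_col:
  assumes "finite I" "finite J" "card I = card J" "cols_indep I J f" and "j \<in> J"
  shows "schur I J f i j = f i j"
proof -
  have "schur I J f i j = (\<Sum>b\<in>J. f i b * (if b = j then 1 else 0))"
    unfolding schur_def by (intro sum.cong refl) (use block_inv(2)[OF assms(1-4) _ assms(5)] in simp)
  also have "\<dots> = f i j" using assms by (simp add: if_distrib[of "(*) _"] cong: if_cong)
  finally show ?thesis .
qed

lemma schur_cong:
  assumes "finite I" "finite J" "\<And>a b. a \<in> I \<Longrightarrow> b \<in> J \<Longrightarrow> f a b = g a b"
    and "\<And>b. b \<in> J \<Longrightarrow> f i b = g i b" and "\<And>a. a \<in> I \<Longrightarrow> f a j = g a j"
  shows "schur I J f i j = schur I J g i j"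
proof -
  have "block_inv I J f = block_inv I J g"
    by (intro ext) (simp add: block_inv_def block_cong[of I J f g, OF assms(1-3)])
  then show ?thesis unfolding schur_def using assms(4,5) by simp
qed

text \<open>Row rank is at least column rank: while a column is added, some row has a nonzero Schur complement,
for otherwise the new column would be a combination of the old ones on all of \<open>P\<close>.\<close>

lemma exists_pivot_rows:
  assumes "finite J" and "cols_indep P J f"
  shows "\<exists>I\<subseteq>P. finite I \<and> card I = card J \<and> cols_indep I J f"
  using assms
proof (induction J)
  case empty
  show ?case by (intro exI[of _ "{}"]) (simp add: cols_indep_def)
next
  case (insert b J)
  have "cols_indep P J f"
    unfolding cols_indep_def
  proof (intro allI impI ballI)
    fix c j
    assume c: "\<forall>i\<in>P. (\<Sum>j\<in>J. f i j * c j) = 0" and j: "j \<in> J"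
    have "(c(b := 0)) j = 0"
    proof (rule cols_indepD[OF insert.prems])
      fix i assume "i \<in> P"
      have "(\<Sum>j\<in>J. f i j * (c(b := 0)) j) = (\<Sum>j\<in>J. f i j * c j)"
        using insert.hyps by (intro sum.cong) auto
      then show "(\<Sum>j\<in>insert b J. f i j * (c(b := 0)) j) = 0"
        using c \<open>i \<in> P\<close> insert.hyps by simp
    qed (use j in simp)
    then show "c j = 0" using j insert.hyps by (auto split: if_splits)
  qed
  from insert.IH[OF this] obtain I where I: "I \<subseteq> P" "finite I" "card I = card J" "cols_indep I J f"
    by blast
  have "\<exists>i\<in>P. f i b \<noteq> schur I J f i b"
  proof (rule ccontr)
    assume "\<not> ?thesis"
    then have s: "f i b = schur I J f i b" if "i \<in> P" for i using that by blast
    define c where "c = (\<lambda>j. if j = b then 1 else - (\<Sum>a\<in>I. block_inv I J f j a * f a b))"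
    have "c b = 0"
    proof (rule cols_indepD[OF insert.prems])
      fix i assume "i \<in> P"
      have "(\<Sum>j\<in>J. f i j * c j) = (\<Sum>j\<in>J. - (f i j * (\<Sum>a\<in>I. block_inv I J f j a * f a b)))"
        using insert.hyps by (intro sum.cong) (auto simp: c_def)
      also have "\<dots> = - f i b"
        by (simp add: s[OF \<open>i \<in> P\<close>] schur_def sum_negf)
      finally show "(\<Sum>j\<in>insert b J. f i j * c j) = 0"
        using insert.hyps by (simp add: c_def)
    qed simp
    then show False by (simp add: c_def)
  qed
  then obtain i where i: "i \<in> P" "f i b \<noteq> schur I J f i b" by blast
  then have "i \<notin> I" using schur_pivot_row[OF I(2) insert.hyps(1) I(3,4)] by metis
  moreover have "cols_indep (insert i I) (insert b J) f"
    using cols_indep_bordered[of I J f b i] I insert.hyps i by blast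
  ultimately show ?case
    using I i insert.hyps by (intro exI[of _ "insert i I"]) auto
qed

definition list_mat :: "'x list \<Rightarrow> 'y list \<Rightarrow> ('x \<Rightarrow> 'y \<Rightarrow> complex) \<Rightarrow> complex Matrix.mat" where
  "list_mat R C f = Matrix.mat (length R) (length C) (\<lambda>(a, b). f (R ! a) (C ! b))"

text \<open>The rank of a matrix is the dimension of the span of its set of columns. The two lemmas of this
context restate it as the largest size of an independent set of column indices; repeated columns
collapse in the set of columns, but an independent set of indices has no repetitions.\<close>

context
  fixes R :: "'x list" and C :: "'y list" and f :: "'x \<Rightarrow> 'y \<Rightarrow> complex"
begin

private definition colv where "colv j = Matrix.vec (length R) (\<lambda>a. f (R ! a) j)"

private lemma set_cols: "set (cols (list_mat R C f)) = colv ` set C"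
proof -
  have "cols (list_mat R C f) = map colv C"
    by (rule nth_equalityI) (auto simp: list_mat_def colv_def intro!: eq_vecI)
  then show ?thesis by simp
qed

private lemma A: "list_mat R C f \<in> carrier_mat (length R) (length C)"
  by (simp add: list_mat_def)

private lemma rank: "mat_rank (list_mat R C f) = vec_space.rank (length R) (list_mat R C f)"
  unfolding mat_rank_def using A by simp

lemma cols_indep_le_mat_rank:
  assumes "J \<subseteq> set C" and "cols_indep (set R) J f"
  shows "card J \<le> mat_rank (list_mat R C f)"
proof -
  interpret V: vec_space "TYPE(complex)" "length R" .
  have fin: "finite J" using assms(1) finite_subset by blast
  have inj: "inj_on colv J"
  proof (rule inj_onI, rule ccontr)
    fix j j' assume j: "j \<in> J" "j' \<in> J" "colv j = colv j'" "j \<noteq> j'"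
    let ?c = "\<lambda>k. (if k = j then 1 else 0) - (if k = j' then 1 else 0 :: complex)"
    have "?c j = 0"
    proof (rule cols_indepD[OF assms(2), of ?c])
      fix i assume "i \<in> set R"
      then obtain a where a: "a < length R" "i = R ! a" by (auto simp: in_set_conv_nth)
      have "f i j = f i j'" using arg_cong[OF j(3), of "\<lambda>v. vec_index v a"] a by (simp add: colv_def)
      then show "(\<Sum>k\<in>J. f i k * ?c k) = 0"
        using j fin by (simp add: right_diff_distrib sum_subtractf if_distrib[of "(*) _"] cong: if_cong)
    qed (rule j)
    then show False using j(4) by simp
  qed
  have car: "colv ` J \<subseteq> carrier_vec (length R)" by (auto simp: colv_def)
  have "V.lin_indpt (colv ` J)"
  proof
    assume "V.lin_dep (colv ` J)"
    then obtain a v where a: "V.lincomb a (colv ` J) = 0\<^sub>v (length R)" and v: "v \<in> colv ` J" "a v \<noteq> 0"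
      using V.finite_lin_dep[of "colv ` J"] fin car by auto
    have "a (colv j) = 0" if "j \<in> J" for j
    proof (rule cols_indepD[OF assms(2), of "\<lambda>j. a (colv j)"])
      fix i assume "i \<in> set R"
      then obtain k where k: "k < length R" "i = R ! k" by (auto simp: in_set_conv_nth)
      have "0 = vec_index (V.lincomb a (colv ` J)) k" using k a by simp
      also have "\<dots> = (\<Sum>x\<in>colv ` J. a x * vec_index x k)"
        by (intro V.lincomb_index k car)
      also have "\<dots> = (\<Sum>j\<in>J. a (colv j) * f i j)"
        unfolding sum.reindex[OF inj] using k by (simp add: colv_def)
      finally show "(\<Sum>j\<in>J. f i j * a (colv j)) = 0" by (simp add: mult.commute)
    qed (rule that)
    then show False using v by auto
  qed
  then have "card (colv ` J) \<le> mat_rank (list_mat R C f)"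
    unfolding rank using assms(1) by (intro V.rank_ge_card_indpt[OF A]) (auto simp: set_cols)
  then show ?thesis by (simp add: card_image[OF inj])
qed

lemma exists_cols_indep_mat_rank:
  "\<exists>J\<subseteq>set C. card J = mat_rank (list_mat R C f) \<and> cols_indep (set R) J f"
proof -
  interpret V: vec_space "TYPE(complex)" "length R" .
  let ?P = "\<lambda>T. T \<subseteq> colv ` set C \<and> V.lin_indpt T"
  have "?P {}" by (simp add: V.lin_dep_def)
  then obtain U where U: "finite U" "maximal U ?P"
    using maximal_exists_superset[of "colv ` set C" ?P "{}"] by auto
  then have rk: "mat_rank (list_mat R C f) = card U"
    unfolding rank by (intro V.rank_card_indpt[OF A]) (simp add: set_cols)
  have P: "?P U" using U(2) by (auto simp: maximal_def)
  then obtain J where J: "J \<subseteq> set C" "inj_on colv J" "U = colv ` J"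
    by (metis subset_image_inj)
  have fin: "finite J" using J(1) finite_subset by blast
  have "cols_indep (set R) J f"
    unfolding cols_indep_def
  proof (intro allI impI ballI, rule ccontr)
    fix c j assume c: "\<forall>i\<in>set R. (\<Sum>j\<in>J. f i j * c j) = 0" and j: "j \<in> J" "c j \<noteq> 0"
    define a where "a = (\<lambda>u. c (the_inv_into J colv u))"
    have a: "a (colv k) = c k" if "k \<in> J" for k
      using that by (simp add: a_def the_inv_into_f_f[OF J(2)])
    have car: "U \<subseteq> carrier_vec (length R)" using J(3) by (auto simp: colv_def)
    have "V.lincomb a U = 0\<^sub>v (length R)"
    proof (rule eq_vecI)
      fix k assume "k < dim_vec (0\<^sub>v (length R) :: complex Matrix.vec)"
      then have k: "k < length R" by simp
      have "vec_index (V.lincomb a U) k = (\<Sum>x\<in>U. a x * vec_index x k)"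
        by (intro V.lincomb_index k car)
      also have "\<dots> = (\<Sum>j\<in>J. f (R ! k) j * c j)"
        unfolding J(3) sum.reindex[OF J(2)] using k a by (intro sum.cong) (auto simp: colv_def)
      also have "\<dots> = 0" using c k by simp
      finally show "vec_index (V.lincomb a U) k = vec_index (0\<^sub>v (length R)) k" using k by simp
    qed (use V.lincomb_dim[OF U(1) car] in simp)
    then have "V.lin_dep U"
      unfolding V.lin_dep_def using j a J(3) U(1)
      by (intro exI[of _ U] exI[of _ a] exI[of _ "colv j"]) auto
    then show False using P by blast
  qed
  then show ?thesis using rk J card_image[OF J(2)] by auto
qed

end

section \<open>Elimination by shears\<close>

lemma cols_indep_cong:
  "(\<And>i j. i \<in> P \<Longrightarrow> j \<in> J \<Longrightarrow> f i j = g i j) \<Longrightarrow> cols_indep P J f \<longleftrightarrow> cols_indep P J g"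
  unfolding cols_indep_def by simp

lemma schur_eq_row_combination:
  "schur I J f i j = (\<Sum>a\<in>I. (\<Sum>b\<in>J. f i b * block_inv I J f b a) * f a j)"
  unfolding schur_def sum_distrib_left sum_distrib_right mult.assoc by (rule sum.swap)

definition rows_span :: "'x set \<Rightarrow> 'y set \<Rightarrow> 'x set \<Rightarrow> ('x \<Rightarrow> 'y \<Rightarrow> complex) \<Rightarrow> bool" where
  "rows_span P D I f \<longleftrightarrow> (\<forall>i\<in>P. \<exists>c. \<forall>j\<in>D. f i j = (\<Sum>a\<in>I. c a * f a j))"

lemma rows_span_trans:
  assumes "rows_span P D Q f" and "rows_span Q D I f"
  shows "rows_span P D I f"
  unfolding rows_span_def
proof
  fix i assume "i \<in> P"
  then obtain c where c: "\<And>j. j \<in> D \<Longrightarrow> f i j = (\<Sum>q\<in>Q. c q * f q j)"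
    using assms(1) unfolding rows_span_def by blast
  obtain e where e: "\<And>q j. q \<in> Q \<Longrightarrow> j \<in> D \<Longrightarrow> f q j = (\<Sum>a\<in>I. e q a * f a j)"
    using assms(2) unfolding rows_span_def by metis
  have "f i j = (\<Sum>a\<in>I. (\<Sum>q\<in>Q. c q * e q a) * f a j)" if "j \<in> D" for j
  proof -
    have "f i j = (\<Sum>q\<in>Q. c q * (\<Sum>a\<in>I. e q a * f a j))"
      unfolding c[OF that] by (intro sum.cong refl) (simp add: e[OF _ that])
    also have "\<dots> = (\<Sum>a\<in>I. (\<Sum>q\<in>Q. c q * e q a) * f a j)"
      unfolding sum_distrib_left sum_distrib_right mult.assoc by (rule sum.swap)
    finally show ?thesis .
  qed
  then show "\<exists>c. \<forall>j\<in>D. f i j = (\<Sum>a\<in>I. c a * f a j)"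
    by (intro exI[of _ "\<lambda>a. \<Sum>q\<in>Q. c q * e q a"]) simp
qed

lemma rows_span_schur:
  "(\<And>i j. i \<in> P \<Longrightarrow> j \<in> D \<Longrightarrow> f i j = schur I J f i j) \<Longrightarrow> rows_span P D I f"
  unfolding rows_span_def
proof
  fix i assume "i \<in> P" and "\<And>i j. i \<in> P \<Longrightarrow> j \<in> D \<Longrightarrow> f i j = schur I J f i j"
  then show "\<exists>c. \<forall>j\<in>D. f i j = (\<Sum>a\<in>I. c a * f a j)"
    by (intro exI[of _ "\<lambda>a. \<Sum>b\<in>J. f i b * block_inv I J f b a"])
      (simp flip: schur_eq_row_combination)
qed

text \<open>A linear relation among columns that holds on spanning rows holds on all rows.\<close>

lemma rows_span_cols_indep:
  assumes "rows_span P D I f" "J \<subseteq> D" "cols_indep P J f"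
  shows "cols_indep I J f"
  unfolding cols_indep_def
proof (intro allI impI ballI)
  fix c j assume c: "\<forall>i\<in>I. (\<Sum>j\<in>J. f i j * c j) = 0" and j: "j \<in> J"
  show "c j = 0"
  proof (rule cols_indepD[OF assms(3)])
    fix i assume "i \<in> P"
    then obtain e where e: "\<And>j. j \<in> D \<Longrightarrow> f i j = (\<Sum>a\<in>I. e a * f a j)"
      using assms(1) unfolding rows_span_def by blast
    have "(\<Sum>j\<in>J. f i j * c j) = (\<Sum>j\<in>J. (\<Sum>a\<in>I. e a * f a j) * c j)"
      using e assms(2) by (intro sum.cong refl) (metis subsetD)
    also have "\<dots> = (\<Sum>a\<in>I. e a * (\<Sum>j\<in>J. f a j * c j))"
      unfolding sum_distrib_left sum_distrib_right mult.assoc by (rule sum.swap)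
    finally show "(\<Sum>j\<in>J. f i j * c j) = 0" using c by simp
  qed (rule j)
qed

lemma exists_pivot_block:
  assumes "rows_span (set R) (set C) I\<^sub>0 f"
  shows "\<exists>I J. I \<subseteq> I\<^sub>0 \<and> J \<subseteq> set C \<and> finite I \<and> finite J \<and> card I = mat_rank (list_mat R C f) \<and>
    card J = mat_rank (list_mat R C f) \<and> cols_indep I J f"
proof -
  obtain J where J: "J \<subseteq> set C" "card J = mat_rank (list_mat R C f)" "cols_indep (set R) J f"
    using exists_cols_indep_mat_rank[of C R f] by blast
  have fin: "finite J" using J(1) finite_subset by blast
  have "cols_indep I\<^sub>0 J f" by (rule rows_span_cols_indep[OF assms J(1,3)])
  from exists_pivot_rows[OF fin this] obtain I
    where "I \<subseteq> I\<^sub>0" "finite I" "card I = card J" "cols_indep I J f" by blast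
  then show ?thesis using J fin by (intro exI[of _ I] exI[of _ J]) simp
qed

text \<open>A nonzero Schur complement would border the pivot block to a larger invertible block.\<close>

lemma mat_rank_imp_schur:
  assumes "I \<subseteq> set R" "J \<subseteq> set C" "card I = card J" "cols_indep I J f"
    and "mat_rank (list_mat R C f) = card J" and "i \<in> set R" "j \<in> set C"
  shows "f i j = schur I J f i j"
proof (rule ccontr)
  assume s: "f i j \<noteq> schur I J f i j"
  have fin: "finite I" "finite J" using assms(1,2) finite_subset by blast+
  have j: "j \<notin> J" using schur_pivot_col[OF fin assms(3,4), of j i] s by auto
  have "cols_indep (set R) (insert j J) f"
    using assms(1,6) by (intro cols_indep_mono[OF cols_indep_bordered[OF fin assms(3,4) j s]]) simp
  then have "card (insert j J) \<le> mat_rank (list_mat R C f)"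
    using assms(2,7) by (intro cols_indep_le_mat_rank) auto
  then show False using j fin assms(5) by simp
qed

lemma rows_span_imp_mat_rank:
  assumes "I \<subseteq> set R" "J \<subseteq> set C" "card I = card J" "cols_indep I J f"
    and "rows_span (set R) (set C) I f"
  shows "mat_rank (list_mat R C f) = card J"
proof (rule antisym)
  have fin: "finite I" using assms(1) finite_subset by blast
  obtain I' where "I' \<subseteq> I" "card I' = mat_rank (list_mat R C f)"
    using exists_pivot_block[OF assms(5)] by blast
  then show "mat_rank (list_mat R C f) \<le> card J" using card_mono[OF fin, of I'] assms(3) by simp
  show "card J \<le> mat_rank (list_mat R C f)"
    by (rule cols_indep_le_mat_rank[OF assms(2) cols_indep_mono[OF assms(4,1)]])
qed

text \<open>One elimination step. The entries of \<open>X\<close> at the coordinates \<open>e i j\<close> form a matrix with rows \<open>R\<close> and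
columns \<open>D\<close>, and \<open>I \<times> J\<close> is a pivot block. Subtracting the Schur product from the entries in
neither a pivot row nor a pivot column is a shear: the Schur product involves only entries that are
left alone, so adding it back inverts the map, and the domain where the pivot block is invertible
is preserved.\<close>

locale shear_setup =
  fixes e :: "'x \<Rightarrow> 'y \<Rightarrow> 'i::finite" and R I :: "'x set" and D J :: "'y set"
  assumes finR: "finite R" and finD: "finite D" and IR: "I \<subseteq> R" and JD: "J \<subseteq> D"
    and card_eq: "card I = card J"
    and inj: "i \<in> R \<Longrightarrow> i' \<in> R \<Longrightarrow> j \<in> D \<Longrightarrow> j' \<in> D \<Longrightarrow> e i j = e i' j' \<Longrightarrow> i = i' \<and> j = j'"
begin

definition array :: "complex ^ 'i \<Rightarrow> 'x \<Rightarrow> 'y \<Rightarrow> complex" where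
  "array X i j = vec_nth X (e i j)"

definition elim_coords :: "'i set" where
  "elim_coords = (\<lambda>(i, j). e i j) ` ((R - I) \<times> (D - J))"

definition pivot_dom :: "(complex ^ 'i) set" where
  "pivot_dom = {X. cols_indep I J (array X)}"

definition shear :: "complex \<Rightarrow> complex ^ 'i \<Rightarrow> complex ^ 'i" where
  "shear s X = (\<chi> k. vec_nth X k +
     (\<Sum>(i, j)\<in>(R - I) \<times> (D - J). if e i j = k then s * schur I J (array X) i j else 0))"

lemma inj_iff:
  "i \<in> R \<Longrightarrow> i' \<in> R \<Longrightarrow> j \<in> D \<Longrightarrow> j' \<in> D \<Longrightarrow> e i j = e i' j' \<longleftrightarrow> i = i' \<and> j = j'"
  using inj[of i i' j j'] by auto

lemma finI: "finite I" and finJ: "finite J"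
  using finite_subset[OF IR finR] finite_subset[OF JD finD] by simp_all

lemma card_elim_coords: "card elim_coords = (card R - card I) * (card D - card J)"
proof -
  have "inj_on (\<lambda>(i, j). e i j) ((R - I) \<times> (D - J))"
    by (auto simp: inj_on_def inj_iff)
  then show ?thesis
    by (simp add: elim_coords_def card_image card_cartesian_product card_Diff_subset finI finJ IR JD)
qed

lemma shear_other:
  assumes "k \<notin> elim_coords"
  shows "vec_nth (shear s X) k = vec_nth X k"
proof -
  have "(\<Sum>(i, j)\<in>(R - I) \<times> (D - J). if e i j = k then s * schur I J (array X) i j else 0) = 0"
    using assms by (intro sum.neutral) (auto simp: elim_coords_def)
  then show ?thesis by (simp add: shear_def)
qed

lemma shear_elim:
  assumes "i \<in> R - I" "j \<in> D - J"
  shows "vec_nth (shear s X) (e i j) = vec_nth X (e i j) + s * schur I J (array X) i j"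
proof -
  have "(\<Sum>(i', j')\<in>(R - I) \<times> (D - J). if e i' j' = e i j then s * schur I J (array X) i' j' else 0)
      = (\<Sum>q\<in>(R - I) \<times> (D - J). if q = (i, j) then s * schur I J (array X) i j else 0)"
  proof (rule sum.cong[OF refl], clarify)
    fix i' j' assume "i' \<in> R" "i' \<notin> I" "j' \<in> D" "j' \<notin> J"
    then have "e i' j' = e i j \<longleftrightarrow> (i', j') = (i, j)" using assms inj_iff by simp
    then show "(if e i' j' = e i j then s * schur I J (array X) i' j' else 0)
      = (if (i', j') = (i, j) then s * schur I J (array X) i j else 0)" by auto
  qed
  also have "\<dots> = s * schur I J (array X) i j" using assms finR finD by simp
  finally show ?thesis by (simp add: shear_def)
qed

lemma not_elim_coords: "i \<in> R \<Longrightarrow> j \<in> D \<Longrightarrow> i \<in> I \<or> j \<in> J \<Longrightarrow> e i j \<notin> elim_coords"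
proof
  assume ij: "i \<in> R" "j \<in> D" "i \<in> I \<or> j \<in> J" and "e i j \<in> elim_coords"
  then obtain i' j' where "e i j = e i' j'" "i' \<in> R - I" "j' \<in> D - J"
    by (auto simp: elim_coords_def)
  then show False using inj_iff[of i i' j j'] ij by simp
qed

lemma array_shear: "i \<in> R \<Longrightarrow> j \<in> D \<Longrightarrow> i \<in> I \<or> j \<in> J \<Longrightarrow> array (shear s X) i j = array X i j"
  unfolding array_def by (intro shear_other not_elim_coords)

lemma pivot_dom_shear: "shear s X \<in> pivot_dom \<longleftrightarrow> X \<in> pivot_dom"
proof -
  have "cols_indep I J (array (shear s X)) \<longleftrightarrow> cols_indep I J (array X)"
    by (rule cols_indep_cong) (use IR JD in \<open>auto intro: array_shear\<close>)
  then show ?thesis by (simp add: pivot_dom_def)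
qed

lemma schur_shear: "i \<in> R \<Longrightarrow> j \<in> D \<Longrightarrow> schur I J (array (shear s X)) i j = schur I J (array X) i j"
  by (rule schur_cong[OF finI finJ]) (use IR JD in \<open>auto intro!: array_shear\<close>)

lemma shear_shear: "shear (- s) (shear s X) = X"
proof (subst Finite_Cartesian_Product.vec_eq_iff, rule allI)
  fix k
  show "vec_nth (shear (- s) (shear s X)) k = vec_nth X k"
  proof (cases "k \<in> elim_coords")
    case True
    then obtain i j where k: "k = e i j" "i \<in> R - I" "j \<in> D - J" by (auto simp: elim_coords_def)
    then show ?thesis by (simp add: shear_elim schur_shear)
  qed (simp add: shear_other)
qed

lemma elem_map_on_shear: "elem_map_on pivot_dom (shear s)"
proof -
  have arr: "elem_on S (\<lambda>X. array X i j)" for S i j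
    unfolding array_def by (rule elem_on.coord)
  have "elem_on pivot_dom (\<lambda>X. schur I J (array X) i j)" for i j
    unfolding schur_def
    by (intro elem_on_sum elem_on.mult elem_on_block_inv finI finJ card_eq arr) (simp add: pivot_dom_def)
  then have summand: "elem_on pivot_dom (\<lambda>X. if e i j = k then s * schur I J (array X) i j else 0)" for i j k
    by (cases "e i j = k") (simp_all add: elem_on.mult elem_on.const)
  have "elem_on pivot_dom (\<lambda>X. vec_nth X k +
     (\<Sum>(i, j)\<in>(R - I) \<times> (D - J). if e i j = k then s * schur I J (array X) i j else 0))" for k
  proof (intro elem_on.add elem_on_sum elem_on.coord)
    fix q
    show "elem_on pivot_dom (\<lambda>X. case q of (i, j) \<Rightarrow> if e i j = k then s * schur I J (array X) i j else 0)"
      unfolding case_prod_beta by (rule summand)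
  qed
  then show ?thesis
    unfolding elem_map_on_def shear_def by simp
qed

lemma open_pivot_dom: "open pivot_dom"
proof -
  have "continuous_on UNIV (\<lambda>X. Determinant.det (block I J (array X)))"
    by (intro elem_on_continuous elem_on_det_block card_eq) (simp add: array_def elem_on.coord)
  then have "open ((\<lambda>X. Determinant.det (block I J (array X))) -` (- {0}))"
    by (intro open_vimage) auto
  also have "(\<lambda>X. Determinant.det (block I J (array X))) -` (- {0}) = pivot_dom"
    using det_block_iff[OF finI finJ card_eq] by (auto simp: pivot_dom_def)
  finally show ?thesis .
qed

lemma elem_chart_shear: "elem_chart pivot_dom pivot_dom (shear (- 1)) (shear 1)"
proof -
  have "shear 1 (shear (- 1) X) = X" "shear (- 1) (shear 1 X) = X" for X
    using shear_shear[of "- 1" X] shear_shear[of 1 X] by simp_all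
  then show ?thesis
    by (simp only: elem_chart_def open_pivot_dom elem_map_on_shear pivot_dom_shear) simp
qed

end

section \<open>Successive elimination in the unfoldings of a tensor\<close>

lemma mem_multi_indices: "js \<in> set (multi_indices ns) \<longleftrightarrow> list_all2 (<) js ns"
  by (auto simp: multi_indices_def product_lists_set list_all2_map2)

lemma multi_indices_append:
  "i \<in> set (multi_indices ms) \<Longrightarrow> j \<in> set (multi_indices ns) \<Longrightarrow> i @ j \<in> set (multi_indices (ms @ ns))"
  unfolding mem_multi_indices by (rule list_all2_appendI)

lemma multi_indices_length: "j \<in> set (multi_indices ns) \<Longrightarrow> length j = length ns"
  unfolding mem_multi_indices by (rule list_all2_lengthD)

lemma multi_indices_Nil: "set (multi_indices []) = {[]}"
  by (auto simp: mem_multi_indices)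

text \<open>The row indices of an unfolding are the row indices of the previous one, extended by one index.\<close>

lemma multi_indices_snoc:
  "set (multi_indices (ns @ [n])) = (\<lambda>(i, x). i @ [x]) ` (set (multi_indices ns) \<times> {..<n})"
proof (rule Set.set_eqI)
  fix js
  have "list_all2 (<) (i @ [x]) (ns @ [n]) \<longleftrightarrow> list_all2 (<) i ns \<and> x < n" for i x
    by (subst list_all2_rev[symmetric]) auto
  then show "js \<in> set (multi_indices (ns @ [n])) \<longleftrightarrow>
    js \<in> (\<lambda>(i, x). i @ [x]) ` (set (multi_indices ns) \<times> {..<n})"
    by (cases js rule: rev_cases) (auto simp: mem_multi_indices)
qed

abbreviation tt_array :: "(nat list \<Rightarrow> 'i::finite) \<Rightarrow> complex ^ 'i \<Rightarrow> nat list \<Rightarrow> nat list \<Rightarrow> complex" where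
  "tt_array enc X i j \<equiv> vec_nth X (enc (i @ j))"

lemma tt_unfolding_eq_list_mat:
  "tt_unfolding ns enc k X
    = list_mat (multi_indices (take k ns)) (multi_indices (drop k ns)) (tt_array enc X)"
  by (simp add: tt_unfolding_def list_mat_def entry_def Let_def)

text \<open>The prescribed ranks are \<open>r 1\<close>, \<open>r 2\<close>, and so on. The convention \<open>r 0 = 1\<close> treats the whole tensor as a single
nonzero row, which is where the elimination starts.\<close>

locale tensor_chart =
  fixes ns :: "nat list" and enc :: "nat list \<Rightarrow> 'i::finite" and r :: "nat \<Rightarrow> nat"
  assumes enc: "tensor_indexing ns enc" and r0: "r 0 = 1"
begin

definition "prefixes k = set (multi_indices (take k ns))"
definition "suffixes k = set (multi_indices (drop k ns))"
definition "rk X k = mat_rank (tt_unfolding ns enc k X)"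
text \<open>\<open>num_elim k\<close> is the number of coordinates that the first \<open>k\<close> elimination steps straighten. Step \<open>j\<close>
works on a matrix with \<open>r j * ns ! j\<close> rows and one column for each suffix. That the number depends
on the shape and the ranks alone gives all slices the same dimension.\<close>

definition "num_elim k =
  (\<Sum>j<k. (r j * ns ! j - r (Suc j)) * (card (suffixes (Suc j)) - r (Suc j)))"

lemma rk: "rk X k = mat_rank (list_mat (multi_indices (take k ns)) (multi_indices (drop k ns)) (tt_array enc X))"
  by (simp add: rk_def tt_unfolding_eq_list_mat)

lemma finite_prefixes_suffixes: "finite (prefixes k)" "finite (suffixes k)"
  by (simp_all add: prefixes_def suffixes_def)

lemma enc_inj:
  assumes "i \<in> prefixes k" "i' \<in> prefixes k" "j \<in> suffixes k" "j' \<in> suffixes k"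
    and "enc (i @ j) = enc (i' @ j')"
  shows "i = i' \<and> j = j'"
proof -
  have "i @ j \<in> set (multi_indices ns)" "i' @ j' \<in> set (multi_indices ns)"
    using assms(1-4) multi_indices_append[of _ "take k ns" _ "drop k ns"]
    by (auto simp: prefixes_def suffixes_def)
  then have "i @ j = i' @ j'"
    using enc assms(5) by (auto simp: tensor_indexing_def bij_betw_def inj_on_def)
  moreover have "length i = length i'"
    using assms(1,2) by (auto simp: prefixes_def dest!: multi_indices_length)
  ultimately show ?thesis by simp
qed

lemma prefixes_Suc: "k < length ns \<Longrightarrow> prefixes (Suc k) = (\<lambda>(i, x). i @ [x]) ` (prefixes k \<times> {..<ns ! k})"
  by (simp add: prefixes_def take_Suc_conv_app_nth multi_indices_snoc)

lemma Cons_suffixes: "k < length ns \<Longrightarrow> x < ns ! k \<Longrightarrow> j \<in> suffixes (Suc k) \<Longrightarrow> x # j \<in> suffixes k"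
  by (simp add: suffixes_def mem_multi_indices Cons_nth_drop_Suc[symmetric])

text \<open>Fixing the next index in a relation between rows of one unfolding yields a relation between rows
of the next unfolding. Hence the next step of the elimination may ignore all rows whose
prefix is not a pivot.\<close>

lemma rows_span_Suc:
  assumes "k < length ns" and "finite I" and "rows_span (prefixes k) (suffixes k) I (tt_array enc X)"
  shows "rows_span (prefixes (Suc k)) (suffixes (Suc k)) ((\<lambda>(i, x). i @ [x]) ` (I \<times> {..<ns ! k})) (tt_array enc X)"
  unfolding rows_span_def
proof
  fix i' assume "i' \<in> prefixes (Suc k)"
  then obtain i x where i: "i' = i @ [x]" "i \<in> prefixes k" "x < ns ! k"
    using prefixes_Suc[OF assms(1)] by auto
  obtain c where c: "\<And>j. j \<in> suffixes k \<Longrightarrow> vec_nth X (enc (i @ j)) = (\<Sum>a\<in>I. c a * vec_nth X (enc (a @ j)))"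
    using assms(3) i(2) unfolding rows_span_def by blast
  have inj: "inj_on (\<lambda>(i, x). i @ [x]) (I \<times> {..<ns ! k})" by (auto simp: inj_on_def)
  have "vec_nth X (enc (i' @ j)) = (\<Sum>a\<in>(\<lambda>(i, x). i @ [x]) ` (I \<times> {..<ns ! k}).
      (if last a = x then c (butlast a) else 0) * vec_nth X (enc (a @ j)))"
    if "j \<in> suffixes (Suc k)" for j
  proof -
    have "(\<Sum>a\<in>(\<lambda>(i, x). i @ [x]) ` (I \<times> {..<ns ! k}).
        (if last a = x then c (butlast a) else 0) * vec_nth X (enc (a @ j)))
      = (\<Sum>(a, y)\<in>I \<times> {..<ns ! k}. if y = x then c a * vec_nth X (enc (a @ x # j)) else 0)"
      unfolding sum.reindex[OF inj] by (intro sum.cong refl) auto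
    also have "\<dots> = (\<Sum>a\<in>I. c a * vec_nth X (enc (a @ x # j)))"
      using i(3) by (simp add: sum.cartesian_product[symmetric])
    also have "\<dots> = vec_nth X (enc (i @ x # j))"
      using c[OF Cons_suffixes[OF assms(1) i(3) that]] by simp
    finally show ?thesis using i(1) by simp
  qed
  then show "\<exists>c. \<forall>j\<in>suffixes (Suc k). vec_nth X (enc (i' @ j))
      = (\<Sum>a\<in>(\<lambda>(i, x). i @ [x]) ` (I \<times> {..<ns ! k}). c a * vec_nth X (enc (a @ j)))"
    by (intro exI[of _ "\<lambda>a. if last a = x then c (butlast a) else 0"]) simp
qed

text \<open>The invariant of the elimination after \<open>k\<close> unfoldings, near the tensor \<open>p\<close>. In the chart the first \<open>k\<close> rank
conditions say that the coordinates in \<open>B\<close> vanish, and all other coordinates are those of the tensor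
itself. The pivot rows \<open>I\<close> of the last unfolding have not been touched by the chart, so that
the next step can read their entries off the tensor or off its image alike.\<close>

definition chart_upto :: "nat \<Rightarrow> complex ^ 'i \<Rightarrow> (complex ^ 'i) set \<Rightarrow> (complex ^ 'i) set \<Rightarrow>
    (complex ^ 'i \<Rightarrow> complex ^ 'i) \<Rightarrow> (complex ^ 'i \<Rightarrow> complex ^ 'i) \<Rightarrow> 'i set \<Rightarrow> nat list set \<Rightarrow> bool" where
  "chart_upto k p U V \<phi> \<psi> B I \<longleftrightarrow>
     elem_chart U V \<phi> \<psi> \<and> p \<in> U \<and>
     (\<forall>X\<in>U. \<forall>e. e \<notin> B \<longrightarrow> vec_nth (\<phi> X) e = vec_nth X e) \<and>
     I \<subseteq> prefixes k \<and> card I = r k \<and>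
     (\<forall>i\<in>I. \<forall>j\<in>suffixes k. enc (i @ j) \<notin> B) \<and>
     (\<forall>X\<in>U. (\<forall>e\<in>B. vec_nth (\<phi> X) e = 0) \<longleftrightarrow> (\<forall>j\<in>{1..k}. rk X j = r j)) \<and>
     (\<forall>X\<in>U. (\<forall>j\<in>{1..k}. rk X j = r j) \<longrightarrow> rows_span (prefixes k) (suffixes k) I (tt_array enc X)) \<and>
     card B = num_elim k"

lemma chart_upto_0: "chart_upto 0 p UNIV UNIV (\<lambda>X. X) (\<lambda>X. X) {} {[]}"
proof -
  have "rows_span {[]} (suffixes 0) {[]} (tt_array enc X)" for X
    unfolding rows_span_def by (auto intro: exI[of _ "\<lambda>_. 1"])
  then show ?thesis
    by (simp add: chart_upto_def elem_chart_def elem_map_on_def elem_on.coord prefixes_def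
        multi_indices_Nil r0 num_elim_def)
qed

text \<open>The matrix of the new step consists of the pivot rows \<open>I\<close>, extended by the next index, against the
remaining indices. On tensors with the first \<open>k\<close> ranks as prescribed its rows span all rows of the
new unfolding, so the new rank condition holds iff its Schur complement vanishes.
The new chart is the old one followed by the shear of the elimination step.\<close>

lemma chart_upto_Suc:
  assumes ch: "chart_upto k p U V \<phi> \<psi> B I" and k: "Suc k < length ns"
    and p: "\<And>j. j \<in> {1..Suc k} \<Longrightarrow> rk p j = r j"
  shows "\<exists>U V \<phi> \<psi> B I. chart_upto (Suc k) p U V \<phi> \<psi> B I"
proof -
  from ch have chart: "elem_chart U V \<phi> \<psi>" and pU: "p \<in> U"
    and off: "\<And>X e. X \<in> U \<Longrightarrow> e \<notin> B \<Longrightarrow> vec_nth (\<phi> X) e = vec_nth X e"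
    and I: "I \<subseteq> prefixes k" "card I = r k"
    and IB: "\<And>i j. i \<in> I \<Longrightarrow> j \<in> suffixes k \<Longrightarrow> enc (i @ j) \<notin> B"
    and zero: "\<And>X. X \<in> U \<Longrightarrow> (\<forall>e\<in>B. vec_nth (\<phi> X) e = 0) \<longleftrightarrow> (\<forall>j\<in>{1..k}. rk X j = r j)"
    and span: "\<And>X. X \<in> U \<Longrightarrow> (\<forall>j\<in>{1..k}. rk X j = r j) \<Longrightarrow>
      rows_span (prefixes k) (suffixes k) I (tt_array enc X)"
    and cardB: "card B = num_elim k"
    unfolding chart_upto_def by simp_all
  have k': "k < length ns" using k by simp
  have finI: "finite I" using I(1) finite_prefixes_suffixes(1) finite_subset by blast
  let ?snoc = "\<lambda>(i :: nat list, x). i @ [x]"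
  let ?P = "prefixes (Suc k)" and ?D = "suffixes (Suc k)"
  define R where "R = ?snoc ` (I \<times> {..<ns ! k})"
  have RP: "R \<subseteq> ?P" using I(1) prefixes_Suc[OF k'] by (auto simp: R_def)
  have cardR: "card R = r k * ns ! k"
    unfolding R_def by (subst card_image) (auto simp: inj_on_def card_cartesian_product I(2))
  have RB: "enc (i @ j) \<notin> B" if "i \<in> R" "j \<in> ?D" for i j
    using that IB Cons_suffixes[OF k'] by (auto simp: R_def)
  have spanR: "rows_span ?P ?D R (tt_array enc X)" if "X \<in> U" "\<forall>j\<in>{1..k}. rk X j = r j" for X
    unfolding R_def by (rule rows_span_Suc[OF k' finI span[OF that]])
  have rkp: "rk p (Suc k) = r (Suc k)" and spanp: "rows_span ?P ?D R (tt_array enc p)"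
    using p spanR[OF pU] by simp_all
  obtain I' J where I': "I' \<subseteq> R" "finite I'" "card I' = r (Suc k)"
    and J: "J \<subseteq> ?D" "finite J" "card J = r (Suc k)" and indep: "cols_indep I' J (tt_array enc p)"
    using exists_pivot_block[OF spanp[unfolded prefixes_def suffixes_def]] rkp
    unfolding rk suffixes_def by metis
  have I'P: "I' \<subseteq> ?P" using I'(1) RP by blast
  interpret shear_setup "\<lambda>i j. enc (i @ j)" R I' ?D J
  proof
    show "i = i' \<and> j = j'"
      if "i \<in> R" "i' \<in> R" "j \<in> ?D" "j' \<in> ?D" "enc (i @ j) = enc (i' @ j')" for i i' j j'
      using enc_inj[of i "Suc k" i' j j'] that RP by blast
    show "finite R" using RP finite_prefixes_suffixes(1) finite_subset by blast
  qed (use I' J finite_prefixes_suffixes in auto)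
  have array: "array = tt_array enc" by (intro ext) (simp add: array_def)
  let ?B = "elim_coords"
  have disj: "B \<inter> ?B = {}" using RB by (auto simp: elim_coords_def)
  have fix_array: "array (\<phi> X) i j = array X i j" if "X \<in> U" "i \<in> R" "j \<in> ?D" for X i j
    using off[OF that(1) RB[OF that(2,3)]] by (simp add: array_def)
  have dom: "\<phi> X \<in> pivot_dom \<longleftrightarrow> cols_indep I' J (tt_array enc X)" if "X \<in> U" for X
    unfolding pivot_dom_def mem_Collect_eq
    by (rule cols_indep_cong) (use fix_array[OF that] I' J in \<open>auto simp: array_def\<close>)
  have schur_fix: "schur I' J (array (\<phi> X)) i j = schur I' J (array X) i j"
    if "X \<in> U" "i \<in> R" "j \<in> ?D" for X i j
    by (rule schur_cong[OF I'(2) J(2)]) (use fix_array[OF that(1)] that I'(1) J(1) in auto)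
  define U' where "U' = {X \<in> U. \<phi> X \<in> pivot_dom}"
  define \<phi>' where "\<phi>' = (\<lambda>X. shear (- 1) (\<phi> X))"
  have chart': "elem_chart U' {Y \<in> pivot_dom. shear 1 Y \<in> V} \<phi>' (\<lambda>Y. \<psi> (shear 1 Y))"
    unfolding U'_def \<phi>'_def by (rule elem_chart_compose[OF chart elem_chart_shear])
  have elim: "vec_nth (\<phi>' X) (enc (i @ j)) = tt_array enc X i j - schur I' J (tt_array enc X) i j"
    if "X \<in> U" "i \<in> R - I'" "j \<in> ?D - J" for X i j
  proof -
    have ij: "i \<in> R" "j \<in> ?D" using that by auto
    show ?thesis
      using shear_elim[OF that(2,3), of "- 1" "\<phi> X"] schur_fix[OF that(1) ij] off[OF that(1) RB[OF ij]]
      by (simp add: \<phi>'_def array)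
  qed
  have zero_old: "(\<forall>e\<in>B. vec_nth (\<phi>' X) e = 0) \<longleftrightarrow> (\<forall>j\<in>{1..k}. rk X j = r j)" if "X \<in> U" for X
  proof -
    have "vec_nth (\<phi>' X) e = vec_nth (\<phi> X) e" if "e \<in> B" for e
      unfolding \<phi>'_def using that disj by (intro shear_other) blast
    then show ?thesis using zero[OF that] by simp
  qed
  have schur_all: "\<forall>i\<in>R. \<forall>j\<in>?D. tt_array enc X i j = schur I' J (tt_array enc X) i j"
    if "X \<in> U'" "\<forall>e\<in>?B. vec_nth (\<phi>' X) e = 0" for X
  proof (intro ballI)
    fix i j assume ij: "i \<in> R" "j \<in> ?D"
    have X: "X \<in> U" "cols_indep I' J (tt_array enc X)" using that(1) dom by (auto simp: U'_def)
    show "tt_array enc X i j = schur I' J (tt_array enc X) i j"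
    proof (cases "i \<in> I' \<or> j \<in> J")
      case True
      then show ?thesis
        using schur_pivot_row[OF I'(2) J(2) _ X(2)] schur_pivot_col[OF I'(2) J(2) _ X(2)] I'(3) J(3)
        by auto
    next
      case False
      then have "i \<in> R - I'" "j \<in> ?D - J" using ij by auto
      moreover from this have "enc (i @ j) \<in> ?B" by (auto simp: elim_coords_def)
      ultimately show ?thesis using elim[OF X(1)] that(2) by force
    qed
  qed
  have span': "rows_span ?P ?D I' (tt_array enc X)"
    if X: "X \<in> U'" and "\<forall>e\<in>?B. vec_nth (\<phi>' X) e = 0" "\<forall>j\<in>{1..k}. rk X j = r j" for X
  proof (rule rows_span_trans)
    show "rows_span ?P ?D R (tt_array enc X)" using X that(3) by (intro spanR) (auto simp: U'_def)
    show "rows_span R ?D I' (tt_array enc X)" using schur_all[OF X that(2)] by (intro rows_span_schur) auto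
  qed
  have zero_new: "(\<forall>e\<in>?B. vec_nth (\<phi>' X) e = 0) \<longleftrightarrow> rk X (Suc k) = r (Suc k)"
    if X: "X \<in> U'" and r: "\<forall>j\<in>{1..k}. rk X j = r j" for X
  proof
    have X': "X \<in> U" "cols_indep I' J (tt_array enc X)" using X dom by (auto simp: U'_def)
    note blk = I'P[unfolded prefixes_def] J(1)[unfolded suffixes_def]
    { assume "\<forall>e\<in>?B. vec_nth (\<phi>' X) e = 0"
      then show "rk X (Suc k) = r (Suc k)"
        unfolding rk using rows_span_imp_mat_rank[OF blk _ X'(2)] span'[OF X _ r] I'(3) J(3)
        by (simp add: prefixes_def suffixes_def) }
    { assume rkX: "rk X (Suc k) = r (Suc k)"
      show "\<forall>e\<in>?B. vec_nth (\<phi>' X) e = 0"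
      proof
        fix e assume "e \<in> ?B"
        then obtain i j where ij: "e = enc (i @ j)" "i \<in> R - I'" "j \<in> ?D - J"
          by (auto simp: elim_coords_def)
        have "tt_array enc X i j = schur I' J (tt_array enc X) i j"
        proof (rule mat_rank_imp_schur[OF blk _ X'(2)])
          show "i \<in> set (multi_indices (take (Suc k) ns))" "j \<in> set (multi_indices (drop (Suc k) ns))"
            using ij RP by (auto simp: prefixes_def suffixes_def)
        qed (use rkX I'(3) J(3) rk in auto)
        then show "vec_nth (\<phi>' X) e = 0" using elim[OF X'(1) ij(2,3)] ij(1) by simp
      qed }
  qed
  have Suc_set: "{1..Suc k} = insert (Suc k) {1..k}" by auto
  have "chart_upto (Suc k) p U' {Y \<in> pivot_dom. shear 1 Y \<in> V} \<phi>' (\<lambda>Y. \<psi> (shear 1 Y)) (B \<union> ?B) I'"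
    unfolding chart_upto_def
  proof (intro conjI ballI allI impI)
    show "p \<in> U'" using pU dom[OF pU] indep by (simp add: U'_def)
    show "vec_nth (\<phi>' X) e = vec_nth X e" if "X \<in> U'" "e \<notin> B \<union> ?B" for X e
      using that off by (simp add: \<phi>'_def shear_other U'_def)
    show "enc (i @ j) \<notin> B \<union> ?B" if "i \<in> I'" "j \<in> ?D" for i j
      using that I'(1) RB not_elim_coords[of i j] by auto
    show *: "(\<forall>e\<in>B \<union> ?B. vec_nth (\<phi>' X) e = 0) \<longleftrightarrow> (\<forall>j\<in>{1..Suc k}. rk X j = r j)" if "X \<in> U'" for X
    proof -
      have "X \<in> U" using that by (simp add: U'_def)
      then show ?thesis
        unfolding Suc_set ball_Un using zero_old zero_new[OF that] by auto
    qed
    show "rows_span ?P ?D I' (tt_array enc X)" if "X \<in> U'" "\<forall>j\<in>{1..Suc k}. rk X j = r j" for X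
      using *[OF that(1)] that(2) by (intro span'[OF that(1)]) auto
    show "card (B \<union> ?B) = num_elim (Suc k)"
      using disj by (simp add: card_Un_disjoint cardB card_elim_coords num_elim_def cardR I'(3) J(3))
  qed (use chart' I'P I'(3) in auto)
  then show ?thesis by blast
qed

lemma exists_chart_upto:
  assumes "k < length ns" and "\<And>j. j \<in> {1..k} \<Longrightarrow> rk p j = r j"
  shows "\<exists>U V \<phi> \<psi> B I. chart_upto k p U V \<phi> \<psi> B I"
  using assms
proof (induction k)
  case 0
  then show ?case using chart_upto_0 by blast
next
  case (Suc k)
  then obtain U V \<phi> \<psi> B I where "chart_upto k p U V \<phi> \<psi> B I" by auto
  then show ?case by (rule chart_upto_Suc) (use Suc.prems in auto)
qed

end

section \<open>Intersecting a cone with the unit sphere\<close>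

lemma Re_scaleR_divide: "Re (c *\<^sub>R w / z) = c * Re (w / z)"
  by (simp add: divide_inverse)

text \<open>The slice is the orthogonal complement of an orthogonal set: two real directions for each coordinate
in \<open>B\<close>, and the direction \<open>z\<close> in the coordinate \<open>s\<close>.\<close>

lemma dim_slice:
  fixes B :: "'i::finite set" and z :: complex
  assumes "s \<notin> B" and "z \<noteq> 0"
  shows "Real_Vector_Spaces.subspace {X :: complex ^ 'i. (\<forall>e\<in>B. vec_nth X e = 0) \<and> Re (vec_nth X s / z) = 0}"
    and "Real_Vector_Spaces.dim {X :: complex ^ 'i. (\<forall>e\<in>B. vec_nth X e = 0) \<and> Re (vec_nth X s / z) = 0}
      = 2 * (CARD('i) - card B) - 1"
proof -
  let ?L = "{X :: complex ^ 'i. (\<forall>e\<in>B. vec_nth X e = 0) \<and> Re (vec_nth X s / z) = 0}"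
  show "Real_Vector_Spaces.subspace ?L"
    unfolding Real_Vector_Spaces.subspace_def
    by (auto simp: add_divide_distrib Re_scaleR_divide)
  define T :: "(complex ^ 'i) set" where
    "T = (\<lambda>(e, u). axis e u) ` (B \<times> {1, \<i>}) \<union> {axis s z}"
  have L: "?L = {X. \<forall>t\<in>T. Linear_Algebra.orthogonal t X}"
  proof -
    have c: "inner 1 w = Re w" "inner \<i> w = Im w" for w by (simp_all add: inner_complex_def)
    have "inner z w = 0 \<longleftrightarrow> Re (w / z) = 0" for w
      using assms(2) by (auto simp: inner_complex_def Re_divide sum_power2_eq_zero_iff complex_eq_iff mult.commute)
    then show ?thesis
      by (auto simp: T_def Linear_Algebra.orthogonal_def inner_axis' c complex_eq_iff)
  qed
  have "independent T"
  proof (rule pairwise_orthogonal_independent)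
    show "pairwise Linear_Algebra.orthogonal T"
      using assms(1)
      by (auto simp: pairwise_def T_def Linear_Algebra.orthogonal_def inner_axis_axis inner_complex_def)
    show "0 \<notin> T" using assms(2) by (auto simp: T_def axis_eq_0_iff)
  qed
  have "inj_on (\<lambda>(e, u). axis e u :: complex ^ 'i) (B \<times> {1, \<i>})"
    by (auto simp: inj_on_def axis_eq_axis complex_eq_iff)
  then have "card ((\<lambda>(e, u). axis e u :: complex ^ 'i) ` (B \<times> {1, \<i>})) = 2 * card B"
    by (simp add: card_image card_cartesian_product complex_eq_iff)
  moreover have "axis s z \<notin> (\<lambda>(e, u). axis e u) ` (B \<times> {1, \<i>})"
    using assms by (auto simp: axis_eq_axis)
  ultimately have "card T = 2 * card B + 1" by (simp add: T_def)
  moreover have "Real_Vector_Spaces.dim {X \<in> UNIV. \<forall>t\<in>Real_Vector_Spaces.span T. Linear_Algebra.orthogonal t X}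
      + Real_Vector_Spaces.dim (Real_Vector_Spaces.span T) = Real_Vector_Spaces.dim (UNIV :: (complex ^ 'i) set)"
    by (rule dim_subspace_orthogonal_to_vectors) auto
  moreover have "{X \<in> UNIV. \<forall>t\<in>Real_Vector_Spaces.span T. Linear_Algebra.orthogonal t X} = ?L"
    unfolding L
  proof (intro equalityI subsetI CollectI conjI ballI UNIV_I)
    fix X t assume X: "X \<in> {X. \<forall>t\<in>T. Linear_Algebra.orthogonal t X}" and t: "t \<in> Real_Vector_Spaces.span T"
    have "Linear_Algebra.orthogonal X t"
      by (rule orthogonal_to_span[OF t]) (use X in \<open>simp add: orthogonal_commute\<close>)
    then show "Linear_Algebra.orthogonal t X" by (simp add: orthogonal_commute)
  qed (simp add: Real_Vector_Spaces.span_base)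
  moreover have "Real_Vector_Spaces.dim (Real_Vector_Spaces.span T) = card T"
    using dim_eq_card_independent[OF \<open>independent T\<close>] by simp
  ultimately show "Real_Vector_Spaces.dim ?L = 2 * (CARD('i) - card B) - 1"
    by (simp add: dim_UNIV)
qed

text \<open>Passing from a cone \<open>M\<close> to its intersection with the unit sphere. Suppose a chart flattens \<open>M\<close> near \<open>p\<close>
and leaves the coordinate \<open>s\<close> alone, where \<open>p\<close> does not vanish there. The real linear functional
\<open>l\<close> with \<open>l p = 1\<close> that reads off this coordinate then turns half of the space into a product: \<open>X\<close>
corresponds to its norm and the point \<open>X / l X\<close> of the hyperplane \<open>l = 1\<close>. The sphere fixes the first
factor and, \<open>M\<close> being a cone, membership in \<open>M\<close> depends on the second one, where the
given chart applies since it preserves \<open>l\<close>.\<close>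

lemma sphere_slice_chart:
  fixes M :: "(complex ^ 'i) set"
  assumes chart: "elem_chart U V \<phi> \<psi>" and pU: "p \<in> U" and pM: "p \<in> M"
    and off: "\<And>X e. X \<in> U \<Longrightarrow> e \<notin> B \<Longrightarrow> vec_nth (\<phi> X) e = vec_nth X e"
    and zero: "\<And>X. X \<in> U \<Longrightarrow> (\<forall>e\<in>B. vec_nth (\<phi> X) e = 0) \<longleftrightarrow> X \<in> M"
    and cone: "\<And>X t :: real. t > 0 \<Longrightarrow> X \<in> M \<Longrightarrow> t *\<^sub>R X \<in> M"
    and s: "s \<notin> B" "vec_nth p s \<noteq> 0"
  shows "\<exists>U V \<phi> \<psi> L. open U \<and> p \<in> U \<and> open V \<and> diffeomorphism U V \<phi> \<psi> \<and>
    Real_Vector_Spaces.subspace L \<and> Real_Vector_Spaces.dim L = 2 * (CARD('i) - card B) - 1 \<and>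
    \<phi> ` ({X \<in> M. norm X = 1} \<inter> U) = V \<inter> L"
proof -
  define z where "z = vec_nth p s"
  define l where "l = (\<lambda>X :: complex ^ 'i. Re (vec_nth X s / z))"
  \<comment> \<open>\<open>l u = 1\<close>, and \<open>u\<close> has no component in \<open>B\<close>\<close>
  define u :: "complex ^ 'i" where "u = axis s z"
  \<comment> \<open>the point of the hyperplane \<open>l = 1\<close> that is encoded in \<open>Q\<close>; the number \<open>l Q + 1\<close> is the norm\<close>
  define w where "w = (\<lambda>Q. \<psi> (Q - l Q *\<^sub>R u + u))"
  \<comment> \<open>the shift by 2 makes \<open>l (\<Phi> X) = norm X - 1\<close>, which vanishes exactly on the sphere\<close>
  define \<Phi> where "\<Phi> = (\<lambda>X. \<phi> (X /\<^sub>R l X) + (norm X - 2) *\<^sub>R u)"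
  define \<Psi> where "\<Psi> = (\<lambda>Q. ((l Q + 1) / norm (w Q)) *\<^sub>R w Q)"
  define U' where "U' = {X. l X > 0 \<and> X /\<^sub>R l X \<in> U}"
  define V' where "V' = {Q. l Q > -1 \<and> Q - l Q *\<^sub>R u + u \<in> V}"
  note ch = elem_chartD[OF chart]
  have z: "z \<noteq> 0" using s by (simp add: z_def)
  have lin: "l (X + Y) = l X + l Y" "l (X - Y) = l X - l Y" "l (c *\<^sub>R X) = c * l X" for X Y c
    by (simp_all add: l_def add_divide_distrib diff_divide_distrib Re_scaleR_divide)
  have lu: "l u = 1" using z by (simp add: l_def u_def axis_def)
  have lp: "l p = 1" using z by (simp add: l_def z_def)
  have l\<phi>: "l (\<phi> X) = l X" if "X \<in> U" for X using off[OF that s(1)] by (simp add: l_def)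
  have l\<psi>: "l (\<psi> Y) = l Y" if "Y \<in> V" for Y using l\<phi>[of "\<psi> Y"] ch(7,8)[OF that] by simp
  have w: "w Q \<in> U" "\<phi> (w Q) = Q - l Q *\<^sub>R u + u" "l (w Q) = 1" "w Q \<noteq> 0" if "Q \<in> V'" for Q
  proof -
    have V: "Q - l Q *\<^sub>R u + u \<in> V" using that by (simp add: V'_def)
    show "w Q \<in> U" "\<phi> (w Q) = Q - l Q *\<^sub>R u + u" using ch(7,8)[OF V] by (simp_all add: w_def)
    show l1: "l (w Q) = 1" using l\<psi>[OF V] by (simp add: w_def lin lu)
    show "w Q \<noteq> 0" using l1 by (auto simp: l_def)
  qed
  have pos: "0 < norm X" if "X \<in> U'" for X using that by (auto simp: U'_def l_def)
  have l\<Phi>: "l (\<Phi> X) = norm X - 1" if "X \<in> U'" for X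
    using that l\<phi>[of "X /\<^sub>R l X"] by (simp add: \<Phi>_def lin lu U'_def)
  have arg\<Phi>: "\<Phi> X - l (\<Phi> X) *\<^sub>R u + u = \<phi> (X /\<^sub>R l X)" if "X \<in> U'" for X
    unfolding l\<Phi>[OF that] by (simp add: \<Phi>_def algebra_simps scaleR_2)
  have w\<Phi>: "w (\<Phi> X) = X /\<^sub>R l X" if "X \<in> U'" for X
    using arg\<Phi>[OF that] ch(6)[of "X /\<^sub>R l X"] that by (simp add: w_def U'_def)
  have \<Phi>V: "\<Phi> X \<in> V'" if "X \<in> U'" for X
    using arg\<Phi>[OF that] l\<Phi>[OF that] pos[OF that] ch(5)[of "X /\<^sub>R l X"] that
    by (simp add: V'_def U'_def)
  have \<Psi>\<Phi>: "\<Psi> (\<Phi> X) = X" if "X \<in> U'" for X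
    using pos[OF that] that by (simp add: \<Psi>_def w\<Phi>[OF that] l\<Phi>[OF that] U'_def)
  have l\<Psi>: "l (\<Psi> Q) = (l Q + 1) / norm (w Q)" and norm\<Psi>: "norm (\<Psi> Q) = l Q + 1" if "Q \<in> V'" for Q
    using w[OF that] that by (simp_all add: \<Psi>_def lin V'_def)
  have arg\<Psi>: "\<Psi> Q /\<^sub>R l (\<Psi> Q) = w Q" and \<Psi>U: "\<Psi> Q \<in> U'" if "Q \<in> V'" for Q
  proof -
    have "l Q + 1 > 0" "norm (w Q) > 0" using w[OF that] that by (simp_all add: V'_def)
    then show 1: "\<Psi> Q /\<^sub>R l (\<Psi> Q) = w Q"
      unfolding l\<Psi>[OF that] by (simp add: \<Psi>_def)
    show "\<Psi> Q \<in> U'"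
      using w(1)[OF that] \<open>l Q + 1 > 0\<close> \<open>norm (w Q) > 0\<close> by (simp add: U'_def 1) (simp add: l\<Psi>[OF that])
  qed
  have \<Phi>\<Psi>: "\<Phi> (\<Psi> Q) = Q" if "Q \<in> V'" for Q
    unfolding \<Phi>_def arg\<Psi>[OF that] norm\<Psi>[OF that] w(2)[OF that]
    by (simp add: algebra_simps scaleR_2)
  have el: "elem_on S (\<lambda>X. complex_of_real (l X))" for S
    unfolding l_def by (intro elem_on_Re elem_on_divide elem_on.coord elem_on.const z)
  have cont_l: "continuous_on S l" for S
    unfolding l_def using z by (intro continuous_intros) auto
  have open1: "open {X. l X > c}" for c
    using continuous_open_vimage[of "{c<..}" l] cont_l[of UNIV]
    by (simp add: vimage_def continuous_on_eq_continuous_at)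
  have U'_eq: "U' = {X \<in> {X. l X > 0}. X /\<^sub>R l X \<in> U}" by (auto simp: U'_def)
  have "open U'"
  proof -
    have "continuous_on {X. l X > 0} (\<lambda>X. X /\<^sub>R l X)"
      by (intro continuous_intros cont_l) auto
    from continuous_open_preimage[OF this open1 ch(1)] show ?thesis
      unfolding U'_eq by (simp add: vimage_def Collect_conj_eq)
  qed
  have "open V'"
  proof -
    have "continuous_on {Q. l Q > -1} (\<lambda>Q. Q - l Q *\<^sub>R u + u)"
      by (intro continuous_intros cont_l)
    from continuous_open_preimage[OF this open1 ch(2)] show ?thesis
      by (simp add: V'_def vimage_def Collect_conj_eq)
  qed
  have el_map\<Phi>: "elem_map_on U' \<Phi>"
  proof -
    have "elem_on U' (\<lambda>X. inverse (complex_of_real (l X)) * vec_nth X e)" for e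
      by (intro elem_on.mult elem_on.inv el elem_on.coord) (auto simp: U'_def)
    then have "elem_map_on U' (\<lambda>X. X /\<^sub>R l X)"
      by (simp add: elem_map_on_def scaleR_conv_of_real[where 'a = complex])
    from elem_map_on_compose[OF ch(3) this]
    have 1: "elem_on U' (\<lambda>X. vec_nth (\<phi> (X /\<^sub>R l X)) e)" for e
      by (auto simp: elem_map_on_def U'_def)
    have 2: "elem_on U' (\<lambda>X. complex_of_real (norm X))"
      using pos by (intro elem_on_norm elem_on.coord) auto
    have "elem_on U' (\<lambda>X. vec_nth (\<phi> (X /\<^sub>R l X)) e + (complex_of_real (norm X) - 2) * vec_nth u e)" for e
      by (intro elem_on.add elem_on.mult elem_on_diff 1 2 elem_on.const)
    then show ?thesis
      by (simp add: elem_map_on_def \<Phi>_def scaleR_conv_of_real[where 'a = complex])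
  qed
  have el_map\<Psi>: "elem_map_on V' \<Psi>"
  proof -
    have "elem_on V' (\<lambda>Q. vec_nth Q e - complex_of_real (l Q) * vec_nth u e + vec_nth u e)" for e
      by (intro elem_on.add elem_on_diff elem_on.mult elem_on.coord el elem_on.const)
    then have "elem_map_on V' (\<lambda>Q. Q - l Q *\<^sub>R u + u)"
      by (simp add: elem_map_on_def scaleR_conv_of_real[where 'a = complex])
    from elem_map_on_compose[OF ch(4) this]
    have 1: "elem_on V' (\<lambda>Q. vec_nth (w Q) e)" for e
      by (auto simp: elem_map_on_def V'_def w_def)
    have 2: "elem_on V' (\<lambda>Q. complex_of_real (norm (w Q)))"
      using w by (intro elem_on_norm 1) auto
    have "elem_on V' (\<lambda>Q. (complex_of_real (l Q) + 1) / complex_of_real (norm (w Q)) * vec_nth (w Q) e)" for e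
      using w by (intro elem_on.mult elem_on_divide elem_on.add el 1 2 elem_on.const) auto
    then show ?thesis
      by (simp add: elem_map_on_def \<Psi>_def scaleR_conv_of_real[where 'a = complex])
  qed
  have chart': "elem_chart U' V' \<Phi> \<Psi>"
    unfolding elem_chart_def
    using \<open>open U'\<close> \<open>open V'\<close> el_map\<Phi> el_map\<Psi> \<Phi>V \<Psi>\<Phi> \<Psi>U \<Phi>\<Psi> by blast
  let ?L = "{X :: complex ^ 'i. (\<forall>e\<in>B. vec_nth X e = 0) \<and> Re (vec_nth X s / z) = 0}"
  have slice: "\<Phi> X \<in> ?L \<longleftrightarrow> X \<in> M \<and> norm X = 1" if X: "X \<in> U'" for X
  proof -
    have lX: "l X > 0" and U: "X /\<^sub>R l X \<in> U" using X by (auto simp: U'_def)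
    have "vec_nth (\<Phi> X) e = vec_nth (\<phi> (X /\<^sub>R l X)) e" if "e \<in> B" for e
    proof -
      have "e \<noteq> s" using that s(1) by blast
      then show ?thesis by (simp add: \<Phi>_def u_def axis_def)
    qed
    then have "(\<forall>e\<in>B. vec_nth (\<Phi> X) e = 0) \<longleftrightarrow> X /\<^sub>R l X \<in> M" using zero[OF U] by simp
    also have "\<dots> \<longleftrightarrow> X \<in> M"
      using cone[of "inverse (l X)" X] cone[of "l X" "X /\<^sub>R l X"] lX by auto
    finally have 1: "(\<forall>e\<in>B. vec_nth (\<Phi> X) e = 0) \<longleftrightarrow> X \<in> M" .
    have "Re (vec_nth (\<Phi> X) s / z) = norm X - 1" using l\<Phi>[OF X] by (simp add: l_def)
    then show ?thesis using 1 by auto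
  qed
  have "\<Phi> ` ({X \<in> M. norm X = 1} \<inter> U') = V' \<inter> ?L"
  proof (intro Set.set_eqI iffI)
    fix Q assume "Q \<in> \<Phi> ` ({X \<in> M. norm X = 1} \<inter> U')"
    then obtain X where "Q = \<Phi> X" "X \<in> M" "norm X = 1" "X \<in> U'" by blast
    then show "Q \<in> V' \<inter> ?L" using slice[of X] \<Phi>V[of X] by simp
  next
    fix Q assume Q: "Q \<in> V' \<inter> ?L"
    then have "\<Psi> Q \<in> {X \<in> M. norm X = 1} \<inter> U'"
      using slice[of "\<Psi> Q"] \<Psi>U[of Q] \<Phi>\<Psi>[of Q] by simp
    then show "Q \<in> \<Phi> ` ({X \<in> M. norm X = 1} \<inter> U')" 
      using \<Phi>\<Psi>[of Q] Q by (intro image_eqI[of Q \<Phi> "\<Psi> Q"]) simp_all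
  qed
  moreover have "p \<in> U'" using pU by (simp add: U'_def lp)
  ultimately show ?thesis
    using \<open>open U'\<close> \<open>open V'\<close> elem_chart_diffeomorphism[OF chart'] dim_slice[OF s(1) z]
    by (intro exI[of _ U'] exI[of _ V'] exI[of _ \<Phi>] exI[of _ \<Psi>] exI[of _ ?L] conjI) assumption+
qed

section \<open>Normalized tensor trains form a submanifold\<close>

lemma mat_rank_scale_le:
  assumes "t \<noteq> 0"
  shows "mat_rank (list_mat R C f) \<le> mat_rank (list_mat R C (\<lambda>i j. t * f i j))"
proof -
  obtain J where J: "J \<subseteq> set C" "card J = mat_rank (list_mat R C f)" "cols_indep (set R) J f"
    using exists_cols_indep_mat_rank[of C R f] by blast
  have "cols_indep (set R) J (\<lambda>i j. t * f i j)"
    using J(3) assms by (simp add: cols_indep_def mult.assoc flip: sum_distrib_left)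
  then show ?thesis using cols_indep_le_mat_rank[OF J(1)] J(2) by simp
qed

lemma mat_rank_scale:
  assumes "t \<noteq> 0"
  shows "mat_rank (list_mat R C (\<lambda>i j. t * f i j)) = mat_rank (list_mat R C f)"
proof (rule antisym)
  show "mat_rank (list_mat R C (\<lambda>i j. t * f i j)) \<le> mat_rank (list_mat R C f)"
    using mat_rank_scale_le[of "inverse t" R C "\<lambda>i j. t * f i j"] assms by (simp flip: mult.assoc)
qed (rule mat_rank_scale_le[OF assms])

lemma frobenius_norm_eq_norm:
  assumes "tensor_indexing ns enc"
  shows "frobenius_norm ns enc X = norm X"
  using sum.reindex_bij_betw[OF assms[unfolded tensor_indexing_def], of "\<lambda>k. (cmod (vec_nth X k))\<^sup>2"]
  by (simp add: frobenius_norm_def entry_def norm_vec_def L2_set_def)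

context tensor_chart
begin

lemma rk_scaleR: "t > 0 \<Longrightarrow> rk (t *\<^sub>R X) k = rk X k"
  using mat_rank_scale[of "complex_of_real t" "multi_indices (take k ns)" "multi_indices (drop k ns)"
      "tt_array enc X"]
  by (simp add: rk scaleR_conv_of_real[where 'a = complex])

text \<open>The chart is the one of the full elimination, restricted to the sphere. The coordinate that this
restriction needs exists because the untouched pivot rows span all rows of the last
unfolding of \<open>p \<noteq> 0\<close> and so cannot all vanish.\<close>

lemma exists_slice_chart:
  assumes d: "d < length ns" and p: "\<And>j. j \<in> {1..d} \<Longrightarrow> rk p j = r j" and "norm p = 1"
  shows "\<exists>U V \<phi> \<psi> L. open U \<and> p \<in> U \<and> open V \<and> diffeomorphism U V \<phi> \<psi> \<and>
    Real_Vector_Spaces.subspace L \<and> Real_Vector_Spaces.dim L = 2 * (CARD('i) - num_elim d) - 1 \<and>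
    \<phi> ` ({X \<in> {X. \<forall>j\<in>{1..d}. rk X j = r j}. norm X = 1} \<inter> U) = V \<inter> L"
proof -
  obtain U V \<phi> \<psi> B I where ch: "chart_upto d p U V \<phi> \<psi> B I"
    using exists_chart_upto[OF d] p by blast
  then have chart: "elem_chart U V \<phi> \<psi>" and pU: "p \<in> U"
    and off: "\<And>X e. X \<in> U \<Longrightarrow> e \<notin> B \<Longrightarrow> vec_nth (\<phi> X) e = vec_nth X e"
    and IB: "\<And>i j. i \<in> I \<Longrightarrow> j \<in> suffixes d \<Longrightarrow> enc (i @ j) \<notin> B"
    and zero: "\<And>X. X \<in> U \<Longrightarrow> (\<forall>e\<in>B. vec_nth (\<phi> X) e = 0) \<longleftrightarrow> (\<forall>j\<in>{1..d}. rk X j = r j)"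
    and span: "rows_span (prefixes d) (suffixes d) I (tt_array enc p)"
    and cardB: "card B = num_elim d"
    using p unfolding chart_upto_def by simp_all
  have "p \<noteq> 0" using assms(3) by auto
  then obtain e where e: "vec_nth p e \<noteq> 0" by (auto simp: Finite_Cartesian_Product.vec_eq_iff)
  have "e \<in> enc ` set (multi_indices ns)"
    using enc by (simp add: tensor_indexing_def bij_betw_def)
  then obtain js where js: "js \<in> set (multi_indices (take d ns @ drop d ns))" "e = enc js" by auto
  then obtain i j where ij: "i \<in> prefixes d" "j \<in> suffixes d" "js = i @ j"
    unfolding mem_multi_indices list_all2_append2 prefixes_def suffixes_def by blast
  obtain c where "tt_array enc p i j = (\<Sum>a\<in>I. c a * tt_array enc p a j)"
    using span ij(1,2) unfolding rows_span_def by blast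
  then have "(\<Sum>a\<in>I. c a * tt_array enc p a j) \<noteq> 0" using e js(2) ij(3) by simp
  then obtain a where "a \<in> I" "c a * tt_array enc p a j \<noteq> 0" by (rule sum.not_neutral_contains_not_neutral)
  then have s: "enc (a @ j) \<notin> B" "tt_array enc p a j \<noteq> 0" using IB ij(2) by auto
  show ?thesis
    unfolding cardB[symmetric]
  proof (rule sphere_slice_chart[OF chart pU _ _ _ _ s])
    show "(\<forall>e\<in>B. vec_nth (\<phi> X) e = 0) \<longleftrightarrow> X \<in> {X. \<forall>j\<in>{1..d}. rk X j = r j}" if "X \<in> U" for X
      using zero[OF that] by simp
  qed (use p off rk_scaleR in auto)
qed

end

theorem mainTheorem1:
  fixes ns :: "nat list" and rs :: "int list" and enc :: "nat list \<Rightarrow> 'i::finite"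
  assumes "ns \<noteq> []" and "\<forall>n\<in>set ns. n \<ge> 1"
    and "tensor_indexing ns enc"
    and "length rs = length ns - 1"
  shows "embedded_submanifold (normalized_tt ns enc (1 # rs @ [1]))"
proof (cases "normalized_tt ns enc (1 # rs @ [1]) = {}")
  case True
  then show ?thesis by (simp add: embedded_submanifold_def submanifold_of_dim_def)
next
  case False
  define d where "d = length ns - 1"
  \<comment> \<open>a negative prescribed rank makes the set empty, which is excluded here, so \<open>nat\<close> loses nothing\<close>
  define r where "r = (\<lambda>k. if k = 0 then 1 else nat (rs ! (k - 1)))"
  interpret tensor_chart ns enc r
    by unfold_locales (use assms(3) in \<open>simp_all add: r_def\<close>)
  have d: "d < length ns" using assms(1) by (simp add: d_def)
  have rank_iff: "map int (tt_rank ns enc X) = 1 # rs @ [1] \<longleftrightarrow> (\<forall>k<d. int (rk X (Suc k)) = rs ! k)" for X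
  proof -
    have "map int (tt_rank ns enc X) = 1 # map (\<lambda>k. int (rk X k)) [1..<length ns] @ [1]"
      by (simp add: tt_rank_def rk_def)
    then have "map int (tt_rank ns enc X) = 1 # rs @ [1] \<longleftrightarrow> map (\<lambda>k. int (rk X k)) [1..<length ns] = rs"
      by simp
    also have "\<dots> \<longleftrightarrow> (\<forall>k<d. int (rk X (Suc k)) = rs ! k)"
      using assms(4) by (subst list_eq_iff_nth_eq) (simp add: d_def)
    finally show ?thesis .
  qed
  obtain X\<^sub>0 where "X\<^sub>0 \<in> normalized_tt ns enc (1 # rs @ [1])" using False by blast
  then have "map int (tt_rank ns enc X\<^sub>0) = 1 # rs @ [1]"
    unfolding normalized_tt_def mem_Collect_eq by (rule conjunct1)
  then have X\<^sub>0: "\<forall>k<d. int (rk X\<^sub>0 (Suc k)) = rs ! k" by (simp only: rank_iff)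
  have nonneg: "0 \<le> rs ! k" if "k < d" for k
    using X\<^sub>0[rule_format, OF that] of_nat_0_le_iff[of "rk X\<^sub>0 (Suc k)"] by linarith
  have "(\<forall>k<d. int (rk X (Suc k)) = rs ! k) \<longleftrightarrow> (\<forall>j\<in>{1..d}. rk X j = r j)" for X
  proof -
    have "(\<forall>j\<in>{1..d}. rk X j = r j) \<longleftrightarrow> (\<forall>k<d. rk X (Suc k) = r (Suc k))"
      unfolding image_Suc_lessThan[symmetric] by auto
    also have "\<dots> \<longleftrightarrow> (\<forall>k<d. int (rk X (Suc k)) = rs ! k)"
      using nonneg by (auto simp: r_def)
    finally show ?thesis ..
  qed
  then have N: "normalized_tt ns enc (1 # rs @ [1])
      = {X \<in> {X. \<forall>j\<in>{1..d}. rk X j = r j}. norm X = 1}"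
    unfolding normalized_tt_def rank_iff frobenius_norm_eq_norm[OF assms(3)] by simp
  have "submanifold_of_dim (2 * (CARD('i) - num_elim d) - 1) (normalized_tt ns enc (1 # rs @ [1]))"
    unfolding submanifold_of_dim_def N
  proof
    fix p assume "p \<in> {X \<in> {X. \<forall>j\<in>{1..d}. rk X j = r j}. norm X = 1}"
    then show "\<exists>U V \<phi> \<psi> L. open U \<and> p \<in> U \<and> open V \<and> diffeomorphism U V \<phi> \<psi> \<and>
      Real_Vector_Spaces.subspace L \<and> Real_Vector_Spaces.dim L = 2 * (CARD('i) - num_elim d) - 1 \<and>
      \<phi> ` ({X \<in> {X. \<forall>j\<in>{1..d}. rk X j = r j}. norm X = 1} \<inter> U) = V \<inter> L"
      by (intro exists_slice_chart[OF d]) simp_all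
  qed
  then show ?thesis unfolding embedded_submanifold_def by blast
qed

end
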